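(* Let $\mathcal{C}=\mathcal{C}_1\cup\mathcal{C}_2\cup\mathcal{C}_3\cup\mathcal{C}_4\subset\mathbb{P}^2(\mathbb{C})$ be a pencil-type conic-line arrangement, where $\mathcal{C}_1,\dots,\mathcal{C}_4$ are the $m=4$ conic-line fibers of a pencil of conic-line arrangements of degree $3$, and the singularities of $\mathcal{C}$ at the base points of the pencil are transversal. Let $\mathcal{N}:=\{P\in\operatorname{Sing}(\mathcal{C}) : P \text{ is non-ordinary}\}$. Assume that $|\mathcal{N}|=4$ and that through each base point of the pencil passes an even number of lines from the set $\operatorname{Irr}(\mathcal{C})$ of irreducible components of $\mathcal{C}$. Then the weak combinatorial type of $\mathcal{C}$ is $W$ (up to relabeling of the components), where $W$ is the abstract weak combinatorial type of a union of four smooth conics $C_1,C_2,C_3,C_4$ and four lines $L_1,L_2,L_3,L_4$ such that, for each $i$, $L_i$ and $C_i$ intersect in an $A_3$ type singularity, and the remaining singularities are exactly nine ordinary singularities of multiplicity $4$, of the following types (the listed components being the ones passing through the point): \begin{enumerate} \item $C_1\cap C_2\cap L_3\cap L_4$ \item $C_1\cap C_2\cap C_3\cap C_4$ \item $C_1\cap C_2\cap C_3\cap C_4$ \item $C_1\cap C_2\cap C_3\cap C_4$ \item $L_1\cap L_2\cap C_3\cap C_4$ \item $C_1\cap L_2\cap L_3\cap C_4$ \item $C_1\cap L_2\cap C_3\cap L_4$ \item $L_1\cap C_2\cap L_3\cap C_4$ \item $L_1\cap C_2\cap C_3\cap L_4$ \end{enumerate}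
   Context: A pencil of conic-line arrangements is a primitive pencil (no fixed component, irreducible general member) of plane curves of degree $d\ge 3$ having at least three reducible and reduced members whose irreducible components are lines and smooth conics; such members are called conic-line fibers, and a pencil-type conic-line arrangement is a reduced curve that is a union of conic-line fibers of such a pencil. A singularity is ordinary if its local branches are smooth with pairwise distinct tangents. Base points being transversal means that the fibers meet transversally there, so each base point is an ordinary singular point of $\mathcal{C}$ of multiplicity $4$, with one branch from each fiber. An $A_3$ singularity formed by a line and a smooth conic is a point where the line is tangent to the conic. The nine points in the list are distinct. Weak combinatorial type of a reduced curve with irreducible components labelled $1,\dots,r$: the data consisting of the set of singular points; the set of labels; for each singular point $P$ the set $\Delta_P$ of local branches at $P$; the map $\phi_P$ assigning to each branch the label of its component; and the map assigning to each pair of branches at $P$ from distinct components their intersection number. *)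

theory Defs
  imports
    "HOL-Analysis.Analysis"
    "HOL-Computational_Algebra.Computational_Algebra"
    "HOL-Computational_Algebra.Field_as_Ring"
    "HOL-Library.Extended_Nat"
begin

section \<open>Plane curves\<close>

text \<open>
  The polynomial ring \<open>\<complex>[x,y,z]\<close> is the nested type \<open>\<complex>[x][y][z]\<close>: the coefficient of
  \<open>x^i y^j z^k\<close> in \<open>F\<close> is \<open>coeff (coeff (coeff F k) j) i\<close>. A plane curve is given by a homogeneous
  equation; two equations give the same curve iff they agree up to a unit, i.e. have the same
  \<open>normalize\<close>.
\<close>

type_synonym poly3 = "complex poly poly poly"

definition homogeneous :: "nat \<Rightarrow> poly3 \<Rightarrow> bool" where
  "homogeneous d F \<longleftrightarrow> (\<forall>i j k. coeff (coeff (coeff F k) j) i \<noteq> 0 \<longrightarrow> i + j + k = d)"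

definition const3 :: "complex \<Rightarrow> poly3" where
  "const3 c = [:[:[:c:]:]:]"

text \<open>Value of \<open>F\<close> at \<open>(x, y, z)\<close> in a ring into which the coefficients are mapped by \<open>h\<close>.\<close>

definition eval3 :: "(complex \<Rightarrow> 'a::comm_ring_1) \<Rightarrow> poly3 \<Rightarrow> 'a \<Rightarrow> 'a \<Rightarrow> 'a \<Rightarrow> 'a" where
  "eval3 h F x y z =
     poly (map_poly (\<lambda>q. poly (map_poly (\<lambda>r. poly (map_poly h r) x) q) y) F) z"

definition proj_rel :: "complex^3 \<Rightarrow> complex^3 \<Rightarrow> bool" where
  "proj_rel u v \<longleftrightarrow> u \<noteq> 0 \<and> (\<exists>c. c \<noteq> 0 \<and> v = c *s u)"

lemma part_equivp_proj_rel: "part_equivp proj_rel"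
proof (rule part_equivpI)
  show "\<exists>x. proj_rel x x"
    unfolding proj_rel_def
    by (rule exI[of _ "1 :: complex^3"], intro conjI exI[of _ 1]) auto
  show "symp proj_rel"
  proof (rule sympI)
    fix u v assume "proj_rel u v"
    then obtain c where "u \<noteq> 0" "c \<noteq> 0" "v = c *s u"
      unfolding proj_rel_def by blast
    then show "proj_rel v u"
      unfolding proj_rel_def
      by (intro conjI exI[of _ "inverse c"])
         (auto simp: vec_eq_iff)
  qed
  show "transp proj_rel"
  proof (rule transpI)
    fix u v w assume "proj_rel u v" "proj_rel v w"
    then obtain c d where "u \<noteq> 0" "c \<noteq> 0" "v = c *s u" "d \<noteq> 0" "w = d *s v"
      unfolding proj_rel_def by blast
    then show "proj_rel u w"
      unfolding proj_rel_def
      by (intro conjI exI[of _ "d * c"]) (auto simp: vec_eq_iff)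
  qed
qed

quotient_type proj_plane = "complex^3" / partial: proj_rel
  by (rule part_equivp_proj_rel)

text \<open>
  \<open>rep_proj_plane P\<close> is some vector of homogeneous coordinates of \<open>P\<close>. For a homogeneous \<open>F\<close> the
  choice affects neither the vanishing of \<open>F\<close> nor, up to a unit and a rescaling of the local
  coordinates, the germ of \<open>F\<close> defined below.
\<close>

definition on_curve :: "poly3 \<Rightarrow> proj_plane \<Rightarrow> bool" where
  "on_curve F P \<longleftrightarrow>
     (let v = rep_proj_plane P in eval3 (\<lambda>c. c) F (v $ 1) (v $ 2) (v $ 3) = 0)"


section \<open>Germs, branches and local intersection numbers\<close>

text \<open>
  The completed local ring at a point is \<open>\<complex>[[s]][[t]]\<close>, where \<open>s, t\<close> are affine coordinates centred
  at the point in a chart obtained by fixing a non-vanishing homogeneous coordinate. The coefficient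
  of \<open>s^i t^j\<close> in \<open>f\<close> is \<open>fps_nth (fps_nth f j) i\<close>.
\<close>

type_synonym fps2 = "complex fps fps"

definition const_fps2 :: "complex \<Rightarrow> fps2" where
  "const_fps2 c = fps_const (fps_const c)"

definition local_eq :: "poly3 \<Rightarrow> proj_plane \<Rightarrow> fps2" where
  "local_eq F P =
     (let v = rep_proj_plane P;
          a = const_fps2 (v $ 1); b = const_fps2 (v $ 2); c = const_fps2 (v $ 3);
          s = fps_const fps_X; t = fps_X
      in if v $ 3 \<noteq> 0 then eval3 const_fps2 F (a + s) (b + t) c
         else if v $ 2 \<noteq> 0 then eval3 const_fps2 F (a + s) b (c + t)
         else eval3 const_fps2 F a (b + s) (c + t))"

definition multiples :: "fps2 \<Rightarrow> fps2 set" where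
  "multiples f = {g. f dvd g}"

definition germ :: "poly3 \<Rightarrow> proj_plane \<Rightarrow> fps2 set" where
  "germ F P = multiples (local_eq F P)"

text \<open>
  The local branches are the irreducible factors of the local equation; a factor is only determined
  up to a unit, hence represented by the principal ideal it generates.
\<close>

definition branches :: "poly3 \<Rightarrow> proj_plane \<Rightarrow> fps2 set set" where
  "branches F P = {multiples b | b. irreducible b \<and> b dvd local_eq F P}"

definition linear_part :: "fps2 \<Rightarrow> complex \<times> complex" where
  "linear_part f = (fps_nth (fps_nth f 0) 1, fps_nth (fps_nth f 1) 0)"

text \<open>
  Let \<open>I\<close> be the principal ideal of a non-unit \<open>f\<close>. Every element of \<open>I\<close> has as linear part a
  scalar multiple of that of \<open>f\<close>, so the following two notions are the smoothness of the germ
  \<open>f = 0\<close> and its tangent space (the tangent line if the germ is smooth).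
\<close>

definition smooth_germ :: "fps2 set \<Rightarrow> bool" where
  "smooth_germ I \<longleftrightarrow> (\<exists>f\<in>I. linear_part f \<noteq> (0, 0))"

definition tangent :: "fps2 set \<Rightarrow> (complex \<times> complex) set" where
  "tangent I =
     {w. \<forall>f\<in>I. fst (linear_part f) * fst w + snd (linear_part f) * snd w = 0}"

text \<open>The complex codimension of an ideal in \<open>\<complex>[[s]][[t]]\<close> (infinite if no finite set spans the quotient).\<close>

definition codim :: "fps2 set \<Rightarrow> enat" where
  "codim I =
     Inf {enat (card B) | B. finite B \<and> (\<forall>f. \<exists>c. f - (\<Sum>b\<in>B. const_fps2 (c b) * b) \<in> I)}"

definition intersection_number :: "fps2 set \<Rightarrow> fps2 set \<Rightarrow> enat" where
  "intersection_number I J = codim {f + g | f g. f \<in> I \<and> g \<in> J}"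


section \<open>Singular points\<close>

definition Sing :: "poly3 \<Rightarrow> proj_plane set" where
  "Sing F = {P. on_curve F P \<and> \<not> smooth_germ (germ F P)}"

definition ordinary_at :: "poly3 \<Rightarrow> proj_plane \<Rightarrow> bool" where
  "ordinary_at F P \<longleftrightarrow>
     (\<forall>B\<in>branches F P. smooth_germ B) \<and>
     (\<forall>B\<in>branches F P. \<forall>B'\<in>branches F P. B \<noteq> B' \<longrightarrow> tangent B \<noteq> tangent B')"

definition non_ordinary_points :: "poly3 \<Rightarrow> proj_plane set" where
  "non_ordinary_points F = {P \<in> Sing F. \<not> ordinary_at F P}"

definition transversal_at :: "poly3 \<Rightarrow> poly3 \<Rightarrow> proj_plane \<Rightarrow> bool" where
  "transversal_at F G P \<longleftrightarrow>
     on_curve F P \<and> on_curve G P \<and> smooth_germ (germ F P) \<and> smooth_germ (germ G P) \<and>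
     tangent (germ F P) \<noteq> tangent (germ G P)"


section \<open>Lines, conics and pencils\<close>

text \<open>Each irreducible component is represented by its unique normalized equation.\<close>

definition Irr :: "poly3 \<Rightarrow> poly3 set" where
  "Irr F = prime_factors F"

definition is_line :: "poly3 \<Rightarrow> bool" where
  "is_line F \<longleftrightarrow> F \<noteq> 0 \<and> homogeneous 1 F"

definition is_smooth_conic :: "poly3 \<Rightarrow> bool" where
  "is_smooth_conic F \<longleftrightarrow> F \<noteq> 0 \<and> homogeneous 2 F \<and> Sing F = {}"

definition pencil_members :: "poly3 \<Rightarrow> poly3 \<Rightarrow> poly3 set" where
  "pencil_members F G = {const3 a * F + const3 b * G | a b. (a, b) \<noteq> (0, 0)}"

text \<open>
  Coprimality says that there is no fixed component (and entails that \<open>F, G\<close> are linearly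
  independent). ``The general member is irreducible'' means that all but finitely many of the
  curves in the pencil are irreducible.
\<close>

definition primitive_pencil :: "nat \<Rightarrow> poly3 \<Rightarrow> poly3 \<Rightarrow> bool" where
  "primitive_pencil d F G \<longleftrightarrow>
     homogeneous d F \<and> homogeneous d G \<and> coprime F G \<and>
     finite (normalize ` {M \<in> pencil_members F G. \<not> irreducible M})"

definition conic_line_fiber :: "poly3 \<Rightarrow> poly3 \<Rightarrow> poly3 \<Rightarrow> bool" where
  "conic_line_fiber F G M \<longleftrightarrow>
     M \<in> pencil_members F G \<and> \<not> irreducible M \<and> squarefree M \<and>
     (\<forall>D\<in>Irr M. is_line D \<or> is_smooth_conic D)"

definition conic_line_pencil :: "nat \<Rightarrow> poly3 \<Rightarrow> poly3 \<Rightarrow> bool" where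
  "conic_line_pencil d F G \<longleftrightarrow>
     d \<ge> 3 \<and> primitive_pencil d F G \<and>
     (\<exists>S \<subseteq> normalize ` {M. conic_line_fiber F G M}. card S = 3)"

definition base_points :: "poly3 \<Rightarrow> poly3 \<Rightarrow> proj_plane set" where
  "base_points F G = {P. on_curve F P \<and> on_curve G P}"


section \<open>Weak combinatorial types\<close>

text \<open>Labels, singular points, \<open>\<Delta>_P\<close>, \<open>\<phi>_P\<close>, and the intersection numbers of pairs of branches.\<close>

record ('l, 'p, 'b) weak_type =
  labels :: "'l set"
  points :: "'p set"
  Delta :: "'p \<Rightarrow> 'b set"
  phi :: "'p \<Rightarrow> 'b \<Rightarrow> 'l"
  inum :: "'p \<Rightarrow> 'b \<Rightarrow> 'b \<Rightarrow> enat"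

text \<open>
  Equality up to relabelling of the components, singular points and branches. Intersection numbers
  only matter for branches of distinct components; the degrees of the components are not part of
  the data.
\<close>

definition weak_type_iso ::
  "('l, 'p, 'b) weak_type \<Rightarrow> ('k, 'q, 'c) weak_type \<Rightarrow> bool" where
  "weak_type_iso V W \<longleftrightarrow>
     (\<exists>\<sigma> \<tau> \<beta>.
        bij_betw \<sigma> (labels V) (labels W) \<and>
        bij_betw \<tau> (points V) (points W) \<and>
        (\<forall>P\<in>points V.
           bij_betw (\<beta> P) (Delta V P) (Delta W (\<tau> P)) \<and>
           (\<forall>b\<in>Delta V P. phi W (\<tau> P) (\<beta> P b) = \<sigma> (phi V P b)) \<and>
           (\<forall>b\<in>Delta V P. \<forall>b'\<in>Delta V P. phi V P b \<noteq> phi V P b' \<longrightarrow>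
              inum W (\<tau> P) (\<beta> P b) (\<beta> P b') = inum V P b b')))"

definition weak_type_of :: "poly3 \<Rightarrow> (poly3, proj_plane, fps2 set) weak_type" where
  "weak_type_of F =
     \<lparr> labels = Irr F,
       points = Sing F,
       Delta = branches F,
       phi = (\<lambda>P b. THE D. D \<in> Irr F \<and> b \<in> branches D P),
       inum = (\<lambda>P. intersection_number) \<rparr>"

datatype component = Conic nat | Line nat

datatype sing_point = Tangency nat | Quadruple nat

text \<open>The components through the nine quadruple points; list positions start at 0.\<close>

definition quadruple_points :: "component set list" where
  "quadruple_points =
    [{Conic 1, Conic 2, Line 3, Line 4},
     {Conic 1, Conic 2, Conic 3, Conic 4},
     {Conic 1, Conic 2, Conic 3, Conic 4},
     {Conic 1, Conic 2, Conic 3, Conic 4},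
     {Line 1, Line 2, Conic 3, Conic 4},
     {Conic 1, Line 2, Line 3, Conic 4},
     {Conic 1, Line 2, Conic 3, Line 4},
     {Line 1, Conic 2, Line 3, Conic 4},
     {Line 1, Conic 2, Conic 3, Line 4}]"

text \<open>
  All components are smooth, so a branch at a point is identified with the component carrying it.
  The two branches of an \<open>A_3\<close> point meet with multiplicity 2, and any two branches of an ordinary
  singularity meet with multiplicity 1.
\<close>

definition W_type :: "(component, sing_point, component) weak_type" where
  "W_type =
     \<lparr> labels = Conic ` {1..4} \<union> Line ` {1..4},
       points = Tangency ` {1..4} \<union> Quadruple ` {..<9},
       Delta = (\<lambda>p. case p of Tangency i \<Rightarrow> {Line i, Conic i}
                            | Quadruple k \<Rightarrow> quadruple_points ! k),
       phi = (\<lambda>p b. b),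
       inum = (\<lambda>p b b'. case p of Tangency i \<Rightarrow> 2 | Quadruple k \<Rightarrow> 1) \<rparr>"

end

theory Submission
  imports Defs
begin

text \<open>
  All components are smooth, so a non-ordinary point is a point where two components are tangent; by
  transversality it is not a base point, hence it lies on a single fiber, which must be a conic with
  a tangent line. A fiber has at most one such point, so \<open>|\<N>| = 4\<close> forces every fiber to be a smooth
  conic \<open>Q i\<close> and a line \<open>L i\<close> tangent to it at a point \<open>T i\<close>. Each base point lies on exactly one of
  \<open>L i\<close>, \<open>Q i\<close> for each \<open>i\<close>, and the number of lines through it is \<open>0\<close> or \<open>2\<close>: were it \<open>4\<close>, the lines
  would meet nowhere else, while \<open>L 1\<close> also meets \<open>Q 2\<close>. Hence each of the six pairs of lines
  contributes one base point. Parametrizing \<open>Q 1\<close> from \<open>T 1\<close> turns the equation of \<open>Q 2\<close> into a quartic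
  with simple roots, so \<open>Q 1\<close> and \<open>Q 2\<close> meet in four points; one of them lies on \<open>L 3\<close> and \<open>L 4\<close>, and
  the other three lie on all four conics.

  Locally, pulling power series back along a smooth germ \<open>f = 0\<close> identifies \<open>\<complex>[[s]][[t]]/(f)\<close> with
  a power series ring in one variable. So \<open>f\<close> is prime, which determines the branches of the
  arrangement, and intersection numbers with \<open>f\<close> are vanishing orders.
\<close>

text \<open>The definitions speak of irreducible factors and codimensions in
  \<open>\<complex>[[s]][[t]]\<close> and of arbitrarily chosen representatives of points, while the
  geometry is linear algebra in three variables. The bridge is the linear part of a local equation:
  it records a covector that kills the representative, namely the line itself or the gradient of the
  quadratic form, so tangency becomes proportionality of covectors. The one second-order computation
  is the contact of a line with its conic. A fiber has at most one tangency because a cubic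
  containing a conic has a single further component, a line, and a tangent line meets the conic only
  once. The point \<open>T 1\<close> is a good centre for the parametrization because it lies on no
  other fiber: its parameter value, infinity, is then not a root, and the degree stays four. To
  reach \<open>W\<close>, each base point is sent to the set of indices of the lines through it.
  This set determines all four components at the point, and each set occurs equally often among the
  base points and in the list of nine points, so some bijection respects it.\<close>

no_notation fps_nth (infixl "$" 75)

section \<open>Evaluation of polynomials\<close>

text \<open>One notion for all substitutions used below: the value at a point, the local equation,
  the constant term, the exchange of variables and the pullback \<open>\<rho>\<close>. Each can then
  be applied factor by factor to a product of components.\<close>

definition comm_ring_hom :: "('a::comm_ring_1 \<Rightarrow> 'b::comm_ring_1) \<Rightarrow> bool" where
  "comm_ring_hom h \<longleftrightarrow> h 0 = 0 \<and> h 1 = 1 \<and> (\<forall>x y. h (x + y) = h x + h y) \<and> (\<forall>x y. h (x * y) = h x * h y)"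

lemma comm_ring_homD:
  assumes "comm_ring_hom h"
  shows "h 0 = 0" "h 1 = 1" "h (x + y) = h x + h y" "h (x * y) = h x * h y"
  using assms by (auto simp: comm_ring_hom_def)

lemma comm_ring_hom_more:
  assumes "comm_ring_hom h"
  shows "h (- x) = - h x" "h (x - y) = h x - h y" "h (x ^ n) = h x ^ n"
proof -
  have neg: "h (- z) = - h z" for z
    using comm_ring_homD(3)[OF assms, of z "- z"] comm_ring_homD(1)[OF assms]
    by (simp add: eq_neg_iff_add_eq_0 add.commute)
  then show "h (- x) = - h x" .
  show "h (x - y) = h x - h y"
    using comm_ring_homD(3)[OF assms, of x "- y"] neg by simp
  show "h (x ^ n) = h x ^ n"
    by (induction n) (simp_all add: comm_ring_homD[OF assms])
qed

lemma comm_ring_hom_prod: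
  assumes "comm_ring_hom h"
  shows "h (\<Prod>i\<in>A. f i) = (\<Prod>i\<in>A. h (f i))"
  by (induction A rule: infinite_finite_induct) (simp_all add: comm_ring_homD[OF assms])

lemma comm_ring_hom_dvd:
  assumes "comm_ring_hom h" "x dvd y"
  shows "h x dvd h y"
  using assms by (auto simp: dvd_def comm_ring_hom_def)

text \<open>\<open>eval3\<close> evaluates one variable after the other, the evaluation in the inner
  variables serving as coefficient map \<open>h\<close> for the next one; three applications make it
  a homomorphism.\<close>

lemma comm_ring_hom_poly:
  assumes h: "comm_ring_hom h"
  shows "comm_ring_hom (\<lambda>p. poly (map_poly h p) x)"
proof -
  note [simp] = comm_ring_homD[OF h] map_poly_pCons
  let ?E = "\<lambda>p. poly (map_poly h p) x"
  have add: "?E (p + q) = ?E p + ?E q" for p q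
    by (induction p q rule: poly_induct2) (simp_all add: algebra_simps)
  have smult: "?E (smult a p) = h a * ?E p" for a p
    by (induction p) (simp_all add: algebra_simps)
  have "?E (p * q) = ?E p * ?E q" for p q
    by (induction p) (simp_all add: add smult algebra_simps)
  then show ?thesis
    using add by (simp add: comm_ring_hom_def map_poly_1')
qed

lemma comm_ring_hom_id: "comm_ring_hom (\<lambda>c. c)"
  by (simp add: comm_ring_hom_def)

lemma comm_ring_hom_const_fps2: "comm_ring_hom const_fps2"
  by (simp add: comm_ring_hom_def const_fps2_def flip: fps_const_add fps_const_mult)

lemma comm_ring_hom_eval3:
  "comm_ring_hom h \<Longrightarrow> comm_ring_hom (\<lambda>F. eval3 h F x y z)"
  unfolding eval3_def by (intro comm_ring_hom_poly)

lemma eval3_const3: "comm_ring_hom h \<Longrightarrow> eval3 h (const3 c) x y z = h c"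
  by (simp add: eval3_def const3_def map_poly_pCons comm_ring_homD)

text \<open>In each of the three charts the local coordinates move the representative
  \<open>v\<close> along two coordinate vectors. Naming these directions turns
  \<open>local_eq\<close> into the single substitution
  \<open>v + s * chart1 v + t * chart2 v\<close> and confines the case distinction to a few
  lemmas.\<close>

definition chart1 :: "complex^3 \<Rightarrow> complex^3" where
  "chart1 v = (if v $ 3 \<noteq> 0 then axis 1 1 else if v $ 2 \<noteq> 0 then axis 1 1 else axis 2 1)"

definition chart2 :: "complex^3 \<Rightarrow> complex^3" where
  "chart2 v = (if v $ 3 \<noteq> 0 then axis 2 1 else if v $ 2 \<noteq> 0 then axis 3 1 else axis 3 1)"

lemma three_neq: "(1::3) \<noteq> 2" "(1::3) \<noteq> 3" "(2::3) \<noteq> 3" "(2::3) \<noteq> 1" "(3::3) \<noteq> 1" "(3::3) \<noteq> 2"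
  by auto

definition affine_coord :: "complex^3 \<Rightarrow> 3 \<Rightarrow> fps2" where
  "affine_coord v i = const_fps2 (v $ i) + const_fps2 (chart1 v $ i) * fps_const fps_X
     + const_fps2 (chart2 v $ i) * fps_X"

lemma local_eq_eq:
  "local_eq F P = (let v = rep_proj_plane P in
     eval3 const_fps2 F (affine_coord v 1) (affine_coord v 2) (affine_coord v 3))"
  using three_neq comm_ring_homD[OF comm_ring_hom_const_fps2]
  by (simp add: local_eq_def affine_coord_def chart1_def chart2_def Let_def axis_def)

lemma comm_ring_hom_local_eq: "comm_ring_hom (\<lambda>F. local_eq F P)"
  unfolding local_eq_eq Let_def by (intro comm_ring_hom_eval3 comm_ring_hom_const_fps2)

lemma vec3_eq_0_iff: "(v :: complex^3) = 0 \<longleftrightarrow> v $ 1 = 0 \<and> v $ 2 = 0 \<and> v $ 3 = 0"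
  by (auto simp: vec_eq_iff forall_3)

text \<open>The coordinate kept constant in the chart vanishes on both chart vectors, so it fixes
  the coefficient of \<open>v\<close>; the other two coordinates give the remaining
  coefficients.\<close>

lemma chart_span:
  assumes "v \<noteq> 0"
  obtains \<alpha> \<beta> \<gamma> where "w = \<alpha> *s v + \<beta> *s chart1 v + \<gamma> *s chart2 v"
proof -
  consider "v $ 3 \<noteq> 0" | "v $ 3 = 0" "v $ 2 \<noteq> 0" | "v $ 3 = 0" "v $ 2 = 0" "v $ 1 \<noteq> 0"
    using assms vec3_eq_0_iff by blast
  then show thesis
  proof cases
    case 1
    show thesis
      by (rule that[of "w$3 / v$3" "w$1 - w$3 / v$3 * v$1" "w$2 - w$3 / v$3 * v$2"])
        (use 1 three_neq in \<open>simp add: vec_eq_iff forall_3 chart1_def chart2_def axis_def\<close>)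
  next
    case 2
    show thesis
      by (rule that[of "w$2 / v$2" "w$1 - w$2 / v$2 * v$1" "w$3 - w$2 / v$2 * v$3"])
        (use 2 three_neq in \<open>simp add: vec_eq_iff forall_3 chart1_def chart2_def axis_def\<close>)
  next
    case 3
    show thesis
      by (rule that[of "w$1 / v$1" "w$2 - w$1 / v$1 * v$2" "w$3 - w$1 / v$1 * v$3"])
        (use 3 three_neq in \<open>simp add: vec_eq_iff forall_3 chart1_def chart2_def axis_def\<close>)
  qed
qed

lemma chart_independent:
  assumes "v \<noteq> 0" "\<alpha> *s v + \<beta> *s chart1 v + \<gamma> *s chart2 v = 0"
  shows "\<alpha> = 0 \<and> \<beta> = 0 \<and> \<gamma> = 0"
  using assms three_neq
  by (auto simp: vec_eq_iff forall_3 chart1_def chart2_def axis_def split: if_splits)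

section \<open>The local ring\<close>

definition const_term :: "fps2 \<Rightarrow> complex" where
  "const_term f = fps_nth (fps_nth f 0) 0"

lemma comm_ring_hom_const_term: "comm_ring_hom const_term"
  by (simp add: comm_ring_hom_def const_term_def)

lemma const_term_const_fps2 [simp]: "const_term (const_fps2 c) = c"
  by (simp add: const_term_def const_fps2_def)

lemma is_unit_fps2_iff: "(f :: fps2) dvd 1 \<longleftrightarrow> const_term f \<noteq> 0"
proof
  assume "f dvd 1"
  then have "const_term f dvd const_term 1"
    using comm_ring_hom_dvd comm_ring_hom_const_term by blast
  then show "const_term f \<noteq> 0" by (auto simp: const_term_def)
next
  assume "const_term f \<noteq> 0"
  then have "fps_nth f 0 dvd 1" by (simp add: const_term_def)
  then obtain y where "fps_nth f 0 * y = 1" by (metis dvdE)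
  then show "f dvd 1" using fps_right_inverse by (metis dvdI)
qed

lemma linear_part_add: "linear_part (f + g) = linear_part f + linear_part g"
  by (simp add: linear_part_def)

lemma linear_part_mult:
  "linear_part (f * g) =
     (const_term f * fst (linear_part g) + const_term g * fst (linear_part f),
      const_term f * snd (linear_part g) + const_term g * snd (linear_part f))"
  by (simp add: linear_part_def const_term_def fps_mult_nth)

lemma linear_part_const_fps2 [simp]: "linear_part (const_fps2 c) = (0, 0)"
  by (simp add: linear_part_def const_fps2_def)

lemma linear_part_vars:
  "linear_part (fps_const fps_X) = (1, 0)" "linear_part fps_X = (0, 1)"
  "const_term (fps_const fps_X) = 0" "const_term fps_X = 0"
  by (simp_all add: linear_part_def const_term_def)

text \<open>By this exchange of \<open>s\<close> and \<open>t\<close>, a smooth germ may be assumed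
  to have a nonzero coefficient at \<open>s\<close>.\<close>

definition swap_fps2 :: "fps2 \<Rightarrow> fps2" where
  "swap_fps2 f = Abs_fps (\<lambda>j. Abs_fps (\<lambda>i. fps_nth (fps_nth f i) j))"

lemma swap_fps2_nth [simp]: "fps_nth (fps_nth (swap_fps2 f) i) j = fps_nth (fps_nth f j) i"
  by (simp add: swap_fps2_def)

lemma fps2_eq_iff: "(f :: fps2) = g \<longleftrightarrow> (\<forall>i j. fps_nth (fps_nth f i) j = fps_nth (fps_nth g i) j)"
  by (simp add: fps_eq_iff)

lemma swap_swap_fps2 [simp]: "swap_fps2 (swap_fps2 f) = f"
  by (simp add: fps2_eq_iff)

lemma swap_fps2_mult: "swap_fps2 (f * g) = swap_fps2 f * swap_fps2 g"
  unfolding fps2_eq_iff by (simp add: fps_mult_nth fps_sum_nth) (intro allI sum.swap)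

lemma comm_ring_hom_swap_fps2: "comm_ring_hom swap_fps2"
  by (simp add: comm_ring_hom_def swap_fps2_mult) (simp add: fps2_eq_iff)

lemma swap_const_fps2 [simp]: "swap_fps2 (const_fps2 c) = const_fps2 c"
  by (simp add: fps2_eq_iff const_fps2_def)

lemma const_term_swap_fps2 [simp]: "const_term (swap_fps2 f) = const_term f"
  by (simp add: const_term_def)

lemma linear_part_swap_fps2 [simp]:
  "linear_part (swap_fps2 f) = (snd (linear_part f), fst (linear_part f))"
  by (simp add: linear_part_def)

text \<open>\<open>\<rho>\<close> is the pullback of functions along a parametrization of the smooth germ \<open>f = 0\<close>.\<close>

definition germ_param :: "fps2 \<Rightarrow> (fps2 \<Rightarrow> complex fps) \<Rightarrow> bool" where
  "germ_param f \<rho> \<longleftrightarrow> comm_ring_hom \<rho> \<and> (\<forall>c. \<rho> (const_fps2 c) = fps_const c) \<and> surj \<rho> \<and>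
     (\<forall>g. \<rho> g = 0 \<longleftrightarrow> f dvd g) \<and> (\<forall>g. fps_nth (\<rho> g) 0 = const_term g) \<and>
     (\<exists>a b. (a, b) \<noteq> (0, 0) \<and> a * fst (linear_part f) + b * snd (linear_part f) = 0 \<and>
        (\<forall>g. fps_nth (\<rho> g) 1 = a * fst (linear_part g) + b * snd (linear_part g)))"

text \<open>The copy of \<open>\<complex>[[t]]\<close> inside \<open>\<complex>[[s]][[t]]\<close>.
  The remainders of the division below lie in it, so that \<open>t\<close> becomes the parameter of
  the curve.\<close>

definition const_coeffs :: "complex fps \<Rightarrow> fps2" where
  "const_coeffs r = Abs_fps (\<lambda>n. fps_const (fps_nth r n))"

lemma const_coeffs_nth [simp]: "fps_nth (const_coeffs r) n = fps_const (fps_nth r n)"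
  by (simp add: const_coeffs_def)

lemma comm_ring_hom_const_coeffs: "comm_ring_hom const_coeffs"
proof -
  have "const_coeffs (a * b) = const_coeffs a * const_coeffs b" for a b
    by (simp add: fps2_eq_iff fps_mult_nth fps_sum_nth)
  moreover have "const_coeffs (a + b) = const_coeffs a + const_coeffs b" for a b
    by (rule fps_ext) simp
  moreover have "const_coeffs 0 = 0" by (rule fps_ext) simp
  moreover have "const_coeffs 1 = 1" by (rule fps_ext) simp
  ultimately show ?thesis by (simp add: comm_ring_hom_def)
qed

text \<open>Solves \<open>g = q * f + r\<close> one power of \<open>t\<close> at a time.
  \<open>Q\<close> stands for division by \<open>f(s, 0)\<close>, and the sum collects what the
  earlier coefficients of \<open>q\<close> already contribute.\<close>

fun quotient_coeff :: "(complex fps \<Rightarrow> complex fps) \<Rightarrow> fps2 \<Rightarrow> fps2 \<Rightarrow> nat \<Rightarrow> complex fps" where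
  "quotient_coeff Q f g n =
     Q (fps_nth g n - sum_list (map (\<lambda>k. quotient_coeff Q f g k * fps_nth f (n - k)) [0..<n]))"

declare quotient_coeff.simps [simp del]

text \<open>Weierstrass division by a power series of order one in the inner variable.\<close>

lemma smooth_division:
  assumes "const_term f = 0" "fst (linear_part f) \<noteq> 0"
  obtains q r where "g = q * f + const_coeffs r"
proof -
  define f0 where "f0 = fps_nth f 0"
  have f0: "fps_nth f0 0 = 0" "fps_nth f0 1 \<noteq> 0"
    using assms by (auto simp: f0_def const_term_def linear_part_def)
  then have sub: "subdegree f0 = 1" "f0 \<noteq> 0" by (auto intro!: subdegreeI)
  \<comment> \<open>A one-variable series of order one divides every series without constant term,
    so the remainder is a number.\<close>
  have "\<exists>q. h = q * f0 + fps_const (fps_nth h 0)" for h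
  proof -
    have "f0 dvd h - fps_const (fps_nth h 0)"
    proof (cases "h - fps_const (fps_nth h 0) = 0")
      case False
      then have "subdegree (h - fps_const (fps_nth h 0)) \<ge> 1"
        by (intro subdegree_geI) auto
      then show ?thesis using sub False by (simp add: fps_dvd_iff)
    qed (simp only: dvd_0_right)
    then show ?thesis by (metis dvdE diff_eq_eq mult.commute)
  qed
  then obtain Q where Q: "\<And>h. h = Q h * f0 + fps_const (fps_nth h 0)" by metis
  define q where "q = Abs_fps (quotient_coeff Q f g)"
  define h where "h n = fps_nth g n - (\<Sum>k<n. fps_nth q k * fps_nth f (n - k))" for n
  have q: "fps_nth q n = Q (h n)" for n
    unfolding h_def q_def fps_nth_Abs_fps
    by (subst quotient_coeff.simps) (simp add: interv_sum_list_conv_sum_set_nat lessThan_atLeast0)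
  define r where "r = Abs_fps (\<lambda>n. fps_nth (h n) 0)"
  have "g = q * f + const_coeffs r"
  proof (rule fps_ext)
    fix n
    have "fps_nth (q * f) n = (\<Sum>k\<le>n. fps_nth q k * fps_nth f (n - k))"
      by (simp add: fps_mult_nth atLeast0AtMost)
    also have "{..n} = insert n {..<n}" by auto
    also have "(\<Sum>k\<in>insert n {..<n}. fps_nth q k * fps_nth f (n - k)) =
        fps_nth q n * f0 + (\<Sum>k<n. fps_nth q k * fps_nth f (n - k))"
      by (simp add: f0_def)
    also have "(\<Sum>k<n. fps_nth q k * fps_nth f (n - k)) = fps_nth g n - h n"
      by (simp add: h_def)
    finally have "fps_nth (q * f) n = Q (h n) * f0 + (fps_nth g n - h n)"
      by (simp only: q)
    moreover have "h n - Q (h n) * f0 = fps_nth (const_coeffs r) n"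
      using Q[of "h n"] by (simp add: r_def diff_eq_eq add.commute)
    moreover have "G = A + K" if "A = X + (G - H)" "H - X = K" for A X G H K :: "complex fps"
      using that by auto
    ultimately show "fps_nth g n = fps_nth (q * f + const_coeffs r) n"
      by (metis fps_add_nth)
  qed
  then show thesis by (rule that)
qed

text \<open>Induction on the power of \<open>t\<close>: once the lower coefficients of
  \<open>q\<close> vanish, the next one times \<open>f(s, 0)\<close> equals a constant. Since
  \<open>f(s, 0)\<close> is nonzero and vanishes at \<open>s = 0\<close>, both the coefficient and
  the constant are zero.\<close>

lemma smooth_division_unique:
  assumes "const_term f = 0" "fst (linear_part f) \<noteq> 0" "q * f = const_coeffs r"
  shows "q = 0 \<and> r = 0"
proof -
  define f0 where "f0 = fps_nth f 0"
  have f0: "fps_nth f0 0 = 0" "f0 \<noteq> 0"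
    using assms by (auto simp: f0_def const_term_def linear_part_def)
  have "fps_nth q n = 0 \<and> fps_nth r n = 0" for n
  proof (induction n rule: less_induct)
    case (less n)
    have "fps_nth (q * f) n = (\<Sum>k\<le>n. fps_nth q k * fps_nth f (n - k))"
      by (simp add: fps_mult_nth atLeast0AtMost)
    also have "\<dots> = (\<Sum>k\<le>n. if k = n then fps_nth q n * f0 else 0)"
      using less by (intro sum.cong) (auto simp: f0_def)
    finally have eq: "fps_const (fps_nth r n) = fps_nth q n * f0"
      using assms(3) by simp
    from arg_cong[OF this, of "\<lambda>s. fps_nth s 0"] have "fps_nth r n = 0"
      by (simp add: fps_mult_nth f0)
    with eq f0 show ?case by simp
  qed
  then show ?thesis by (simp add: fps_eq_iff)
qed

text \<open>\<open>\<rho>\<close> is the remainder of the division. Uniqueness of the remainder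
  makes it additive and multiplicative, and the remainder is zero exactly for the multiples of
  \<open>f\<close>.\<close>

lemma germ_param_exists_aux:
  assumes f: "const_term f = 0" "fst (linear_part f) \<noteq> 0"
  shows "\<exists>\<rho>. germ_param f \<rho>"
proof -
  note hom = comm_ring_homD[OF comm_ring_hom_const_coeffs]
    comm_ring_hom_more[OF comm_ring_hom_const_coeffs]
  have "\<exists>r q. g = q * f + const_coeffs r" for g
    using smooth_division[OF f] by metis
  then obtain \<rho> Q where \<rho>: "\<And>g. g = Q g * f + const_coeffs (\<rho> g)" by metis
  have uniq: "\<rho> g = r" if "g = q * f + const_coeffs r" for g q r
  proof -
    have "(Q g - q) * f = const_coeffs (r - \<rho> g)"
      using \<rho>[of g] that by (simp add: hom algebra_simps)
    from smooth_division_unique[OF f this] show ?thesis by simp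
  qed
  have "\<rho> (g + h) = \<rho> g + \<rho> h" for g h
    by (rule uniq[of _ "Q g + Q h"], subst \<rho>[of g], subst \<rho>[of h]) (simp add: hom algebra_simps)
  moreover have "\<rho> (g * h) = \<rho> g * \<rho> h" for g h
    by (rule uniq[of _ "Q g * Q h * f + Q g * const_coeffs (\<rho> h) + Q h * const_coeffs (\<rho> g)"],
        subst \<rho>[of g], subst \<rho>[of h]) (simp add: hom algebra_simps)
  moreover have const: "\<rho> (const_coeffs r) = r" for r
    by (rule uniq[of _ 0]) simp
  moreover have "const_coeffs (fps_const c) = const_fps2 c" for c
    by (rule fps_ext) (simp add: const_fps2_def)
  moreover have "\<rho> g = 0 \<longleftrightarrow> f dvd g" for g
  proof
    assume "\<rho> g = 0"
    with \<rho>[of g] show "f dvd g" by (metis hom(1) add.right_neutral dvd_triv_right)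
  next
    assume "f dvd g"
    then obtain k where "g = k * f" by (metis dvdE mult.commute)
    then show "\<rho> g = 0" by (intro uniq[of _ k]) (simp add: hom)
  qed
  moreover have "fps_nth (\<rho> g) 0 = const_term g" for g
    using arg_cong[OF \<rho>[of g], of const_term] comm_ring_homD[OF comm_ring_hom_const_term] f
    by (simp add: const_term_def)
  moreover have "\<exists>a b. (a, b) \<noteq> (0, 0) \<and> a * fst (linear_part f) + b * snd (linear_part f) = 0 \<and>
        (\<forall>g. fps_nth (\<rho> g) 1 = a * fst (linear_part g) + b * snd (linear_part g))"
  \<comment> \<open>The curve is a graph over the \<open>t\<close>-axis, so its velocity is the
    vector with second entry 1 that the linear part of \<open>f\<close> kills.\<close>
  proof (rule exI[of _ "- snd (linear_part f) / fst (linear_part f)"], rule exI[of _ 1],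
      intro conjI allI)
    fix g
    have "linear_part g = linear_part (Q g * f) + linear_part (const_coeffs (\<rho> g))"
      by (metis \<rho> linear_part_add)
    moreover have "linear_part (const_coeffs r) = (0, fps_nth r 1)" for r
      by (simp add: linear_part_def)
    ultimately have "linear_part g = (const_term (Q g) * fst (linear_part f),
        const_term (Q g) * snd (linear_part f) + fps_nth (\<rho> g) 1)"
      by (simp add: linear_part_mult f)
    then show "fps_nth (\<rho> g) 1 = - snd (linear_part f) / fst (linear_part f) * fst (linear_part g)
        + 1 * snd (linear_part g)"
      using f by simp
  qed (use f in auto)
  ultimately have "germ_param f \<rho>"
    unfolding germ_param_def comm_ring_hom_def
    by (metis hom(1,2) surjI)
  then show ?thesis by blast
qed

lemma germ_param_exists:
  assumes f: "const_term f = 0" "linear_part f \<noteq> (0, 0)"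
  shows "\<exists>\<rho>. germ_param f \<rho>"
proof (cases "fst (linear_part f) = 0")
  case True
  then have "fst (linear_part (swap_fps2 f)) \<noteq> 0" using f by (auto simp: prod_eq_iff)
  then obtain \<rho> where \<rho>: "germ_param (swap_fps2 f) \<rho>"
    using germ_param_exists_aux f by (metis const_term_swap_fps2)
  have "swap_fps2 f dvd swap_fps2 g \<longleftrightarrow> f dvd g" for g
    using comm_ring_hom_dvd[OF comm_ring_hom_swap_fps2] swap_swap_fps2 by metis
  moreover have "surj (\<rho> \<circ> swap_fps2)"
    using \<rho> surjI[of swap_fps2 swap_fps2] by (intro comp_surj) (simp_all add: germ_param_def)
  moreover obtain a b where "(a, b) \<noteq> (0, 0)"
      "a * snd (linear_part f) + b * fst (linear_part f) = 0"
      "\<And>g. fps_nth (\<rho> g) 1 = a * fst (linear_part g) + b * snd (linear_part g)"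
    using \<rho> unfolding germ_param_def by auto
  moreover have "comm_ring_hom (\<rho> \<circ> swap_fps2)"
    using \<rho> comm_ring_homD[OF comm_ring_hom_swap_fps2]
    by (simp add: germ_param_def comm_ring_hom_def)
  moreover have "\<rho> (const_fps2 c) = fps_const c" "\<rho> h = 0 \<longleftrightarrow> swap_fps2 f dvd h"
      "fps_nth (\<rho> h) 0 = const_term h" for c h
    using \<rho> by (auto simp: germ_param_def)
  ultimately have "germ_param f (\<rho> \<circ> swap_fps2)"
    unfolding germ_param_def
    by (intro conjI allI exI[of _ b, OF exI[of _ a]]) (simp_all add: add.commute, auto)
  then show ?thesis by blast
qed (use germ_param_exists_aux f in blast)

lemma smooth_prime_elem:
  assumes "const_term f = 0" "linear_part f \<noteq> (0, 0)"
  shows "prime_elem f"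
proof (rule prime_elemI)
  obtain \<rho> where "germ_param f \<rho>" using germ_param_exists assms by blast
  then have \<rho>: "\<And>x y. \<rho> (x * y) = \<rho> x * \<rho> y" "\<And>g. \<rho> g = 0 \<longleftrightarrow> f dvd g"
    unfolding germ_param_def comm_ring_hom_def by auto
  show "f \<noteq> 0" using assms by (auto simp: linear_part_def)
  show "\<not> f dvd 1" using assms by (simp add: is_unit_fps2_iff)
  show "f dvd a \<or> f dvd b" if "f dvd a * b" for a b
  proof -
    have "\<rho> a * \<rho> b = 0" using that \<rho> by metis
    then show ?thesis using \<rho>(2) by simp
  qed
qed

section \<open>Branches and intersection numbers\<close>

lemma multiples_eq_iff: "multiples f = multiples g \<longleftrightarrow> f dvd g \<and> g dvd f"
  unfolding multiples_def by (metis (no_types, lifting) dvd_refl dvd_trans mem_Collect_eq subsetI subset_antisym)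

lemma irreducible_dvd_sym:
  fixes a b :: "'a :: idom"
  assumes "irreducible b" "a dvd b" "\<not> a dvd 1"
  shows "b dvd a"
proof -
  obtain e where e: "b = a * e" using assms(2) by (rule dvdE)
  then have "e dvd 1" using assms irreducibleD by blast
  then obtain e' where "1 = e * e'" by (rule dvdE)
  then have "a = b * e'" using e by (metis mult.assoc mult.right_neutral)
  then show ?thesis by simp
qed

lemma prime_elem_irreducible:
  fixes p :: "'a :: idom"
  assumes "prime_elem p"
  shows "irreducible p"
proof (rule irreducibleI)
  show "p \<noteq> 0" "\<not> p dvd 1" using assms by (auto simp: prime_elem_def)
  fix a b assume ab: "p = a * b"
  have unit: "y dvd 1" if "p dvd x" "p = x * y" for x y
  proof -
    obtain e where "x = p * e" using \<open>p dvd x\<close> by (rule dvdE)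
    then have "p * 1 = p * (e * y)" using that(2) by (metis mult.assoc mult.right_neutral)
    then have "1 = e * y" using \<open>p \<noteq> 0\<close> mult_left_cancel by blast
    then show ?thesis by (metis dvd_triv_right)
  qed
  have "p dvd a \<or> p dvd b" using assms ab unfolding prime_elem_def by (metis dvd_refl)
  then show "a dvd 1 \<or> b dvd 1" using unit[of a b] unit[of b a] ab mult.commute[of a b] by metis
qed

text \<open>Primeness of one factor at a time decides: if \<open>f D\<close> divides
  \<open>b * c\<close>, then either it divides \<open>b\<close>, hence is associated to it, or it
  divides the cofactor \<open>c\<close> and cancels.\<close>

lemma irreducible_dvd_prime_prod:
  fixes b u :: "'a :: idom"
  assumes "finite S" "\<And>D. D \<in> S \<Longrightarrow> prime_elem (f D)" "irreducible b" "u dvd 1"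
    "b dvd u * (\<Prod>D\<in>S. f D)"
  shows "\<exists>D\<in>S. b dvd f D"
  using assms
proof (induction S rule: finite_induct)
  case empty
  then show ?case by (metis dvd_trans irreducible_def mult.right_neutral prod.empty)
next
  case (insert D S)
  from insert.prems(4) insert.hyps have "b dvd f D * (u * (\<Prod>D\<in>S. f D))"
    by (simp add: mult.left_commute)
  then obtain c where c: "b * c = f D * (u * (\<Prod>D\<in>S. f D))" by (metis dvdE)
  have p: "prime_elem (f D)" using insert by simp
  then have "f D dvd b \<or> f D dvd c" using c by (simp add: prime_elem_def)
  then show ?case
  proof
    assume "f D dvd b"
    then have "b dvd f D"
      using irreducible_dvd_sym insert.prems(2) p by (auto simp: prime_elem_def)
    then show ?thesis by blast
  next
    assume "f D dvd c"
    then obtain e where "c = f D * e" by (rule dvdE)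
    then have "f D * (b * e) = f D * (u * (\<Prod>D\<in>S. f D))"
      using c by (simp add: mult.left_commute)
    then have "b * e = u * (\<Prod>D\<in>S. f D)" using p by (simp add: prime_elem_def)
    then have "b dvd u * (\<Prod>D\<in>S. f D)" by (metis dvd_triv_left)
    then show ?thesis using insert by blast
  qed
qed

lemma branches_eq:
  assumes "finite S" "\<And>D. D \<in> S \<Longrightarrow> prime_elem (f D)" "u dvd 1"
    "local_eq F P = u * (\<Prod>D\<in>S. f D)"
  shows "branches F P = (\<lambda>D. multiples (f D)) ` S"
proof (intro equalityI subsetI)
  fix B assume "B \<in> branches F P"
  then obtain b where b: "B = multiples b" "irreducible b" "b dvd u * (\<Prod>D\<in>S. f D)"
    by (auto simp: branches_def assms(4))
  obtain D where D: "D \<in> S" "b dvd f D"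
    using irreducible_dvd_prime_prod[OF assms(1,2) b(2) assms(3) b(3)] by blast
  then have "irreducible (f D)" using assms(2) prime_elem_irreducible by blast
  then have "f D dvd b" using irreducible_dvd_sym D b(2) irreducible_not_unit by blast
  with D b show "B \<in> (\<lambda>D. multiples (f D)) ` S" by (auto simp: multiples_eq_iff)
next
  fix B assume "B \<in> (\<lambda>D. multiples (f D)) ` S"
  then obtain D where D: "D \<in> S" "B = multiples (f D)" by blast
  then have "f D dvd local_eq F P" using assms(1,4) by (simp add: dvd_prodI dvd_mult)
  with D assms(2) show "B \<in> branches F P"
    unfolding branches_def using prime_elem_irreducible by blast
qed

lemma smooth_germ_multiples:
  assumes "const_term f = 0"
  shows "smooth_germ (multiples f) \<longleftrightarrow> linear_part f \<noteq> (0, 0)"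
proof
  assume "smooth_germ (multiples f)"
  then obtain k where "linear_part (f * k) \<noteq> (0, 0)"
    by (auto simp: smooth_germ_def multiples_def)
  then show "linear_part f \<noteq> (0, 0)" using assms by (auto simp: linear_part_mult)
qed (use dvd_refl in \<open>unfold smooth_germ_def multiples_def, blast\<close>)

lemma tangent_multiples:
  assumes "const_term f = 0"
  shows "tangent (multiples f) =
    {w. fst (linear_part f) * fst w + snd (linear_part f) * snd w = 0}"
proof -
  have "fst (linear_part (f * k)) * x + snd (linear_part (f * k)) * y =
      const_term k * (fst (linear_part f) * x + snd (linear_part f) * y)" for k x y
    using assms by (simp add: linear_part_mult algebra_simps)
  then show ?thesis by (auto simp: tangent_def multiples_def dvd_def)
qed

lemma tangent_multiples_eq_iff:
  assumes "const_term f = 0" "const_term g = 0" "linear_part f \<noteq> (0, 0)" "linear_part g \<noteq> (0, 0)"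
  shows "tangent (multiples f) = tangent (multiples g) \<longleftrightarrow>
    fst (linear_part f) * snd (linear_part g) = snd (linear_part f) * fst (linear_part g)"
proof -
  obtain a b c d where lin: "linear_part f = (a, b)" "linear_part g = (c, d)" by fastforce
  have "(\<forall>x y. a * x + b * y = 0 \<longleftrightarrow> c * x + d * y = 0) \<longleftrightarrow> a * d = b * c"
  proof
    assume "\<forall>x y. a * x + b * y = 0 \<longleftrightarrow> c * x + d * y = 0"
    \<comment> \<open>\<open>(b, - a)\<close> is the direction of the first tangent line.\<close>
    from this[rule_format, of b "- a"] show "a * d = b * c" by (simp add: algebra_simps)
  next
    assume e: "a * d = b * c"
    show "\<forall>x y. a * x + b * y = 0 \<longleftrightarrow> c * x + d * y = 0"
    proof (intro allI)
      fix x y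
      have 1: "a * (c * x + d * y) = c * (a * x + b * y)" "b * (c * x + d * y) = d * (a * x + b * y)"
        using e by (simp_all add: algebra_simps)
      have "a \<noteq> 0 \<or> b \<noteq> 0" "c \<noteq> 0 \<or> d \<noteq> 0" using assms lin by auto
      with 1 show "a * x + b * y = 0 \<longleftrightarrow> c * x + d * y = 0" by (metis mult_eq_0_iff)
    qed
  qed
  then show ?thesis by (simp add: tangent_multiples assms lin set_eq_iff)
qed

text \<open>The ideal contains the kernel of \<open>\<rho>\<close>, hence is the preimage of the
  ideal generated by \<open>\<rho> g\<close>; in one variable, a series of order \<open>k\<close>
  generates everything of order at least \<open>k\<close>.\<close>

lemma intersection_ideal:
  assumes \<rho>: "germ_param f \<rho>" and "\<And>n. n < k \<Longrightarrow> fps_nth (\<rho> g) n = 0" "fps_nth (\<rho> g) k \<noteq> 0"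
  shows "{x + y | x y. x \<in> multiples f \<and> y \<in> multiples g} = {h. \<forall>n<k. fps_nth (\<rho> h) n = 0}"
proof -
  have hom: "comm_ring_hom \<rho>" and ker: "\<And>g. \<rho> g = 0 \<longleftrightarrow> f dvd g" and "surj \<rho>"
    using \<rho> by (auto simp: germ_param_def)
  note [simp] = comm_ring_homD[OF hom] comm_ring_hom_more[OF hom]
  have sub: "subdegree (\<rho> g) = k" "\<rho> g \<noteq> 0" using assms by (auto intro!: subdegreeI)
  have "(\<exists>x y. h = x + y \<and> f dvd x \<and> g dvd y) \<longleftrightarrow> (\<forall>n<k. fps_nth (\<rho> h) n = 0)" for h
  proof
    assume "\<exists>x y. h = x + y \<and> f dvd x \<and> g dvd y"
    then obtain x e where "h = x + g * e" "f dvd x" by (auto elim: dvdE)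
    then have "\<rho> h = \<rho> g * \<rho> e" using ker by simp
    then show "\<forall>n<k. fps_nth (\<rho> h) n = 0" using assms(2) by (simp add: fps_mult_nth)
  next
    assume *: "\<forall>n<k. fps_nth (\<rho> h) n = 0"
    have "\<rho> g dvd \<rho> h"
    proof (cases "\<rho> h = 0")
      case False
      then show ?thesis using * sub by (simp add: fps_dvd_iff subdegree_geI)
    qed simp
    then obtain r where "\<rho> h = \<rho> g * r" by (rule dvdE)
    moreover obtain e where "r = \<rho> e" using \<open>surj \<rho>\<close> by blast
    ultimately have "\<rho> (h - g * e) = 0" by simp
    then have "f dvd h - g * e" using ker by blast
    then show "\<exists>x y. h = x + y \<and> f dvd x \<and> g dvd y"
      by (intro exI[of _ "h - g * e"] exI[of _ "g * e"]) simp
  qed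
  then show ?thesis by (auto simp: multiples_def)
qed

lemma intersection_number_eq_1:
  assumes \<rho>: "germ_param f \<rho>" and "const_term g = 0" "fps_nth (\<rho> g) 1 \<noteq> 0"
  shows "intersection_number (multiples f) (multiples g) = 1"
proof -
  have ct: "fps_nth (\<rho> h) 0 = const_term h" for h using \<rho> by (auto simp: germ_param_def)
  let ?J = "{h. \<forall>n<1. fps_nth (\<rho> h) n = 0}"
  have J: "?J = {h. const_term h = 0}" by (simp add: ct)
  have "{x + y | x y. x \<in> multiples f \<and> y \<in> multiples g} = ?J"
    by (rule intersection_ideal[OF \<rho>]) (use assms ct in auto)
  moreover have "codim {h. const_term h = 0} = 1"
    unfolding codim_def
  proof (rule antisym)
    show "Inf {enat (card B) | B. finite B \<and>
        (\<forall>f. \<exists>c. f - (\<Sum>b\<in>B. const_fps2 (c b) * b) \<in> {h. const_term h = 0})} \<le> 1"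
    proof (rule Inf_lower, intro CollectI exI[of _ "{1}"] conjI allI)
      fix f
      show "\<exists>c. f - (\<Sum>b\<in>{1}. const_fps2 (c b) * b) \<in> {h. const_term h = 0}"
        by (rule exI[of _ "\<lambda>_. const_term f"])
          (simp add: comm_ring_hom_more[OF comm_ring_hom_const_term])
    qed (auto simp: one_enat_def)
    show "1 \<le> Inf {enat (card B) | B. finite B \<and>
        (\<forall>f. \<exists>c. f - (\<Sum>b\<in>B. const_fps2 (c b) * b) \<in> {h. const_term h = 0})}"
    proof (rule Inf_greatest, safe)
      fix B :: "fps2 set"
      assume B: "finite B"
        "\<forall>f. \<exists>c. f - (\<Sum>b\<in>B. const_fps2 (c b) * b) \<in> {h. const_term h = 0}"
      have "B \<noteq> {}"
        using spec[OF B(2), of 1] comm_ring_homD[OF comm_ring_hom_const_term] by auto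
      with B(1) show "1 \<le> enat (card B)" by (simp add: one_enat_def card_gt_0_iff Suc_leI)
    qed
  qed
  ultimately show ?thesis by (simp only: intersection_number_def J)
qed

text \<open>Because \<open>codim\<close> is an infimum over spanning sets, a basis gives only the
  upper bound; the lower bound has to exclude every spanning set with fewer than two
  elements.\<close>

lemma intersection_number_eq_2:
  assumes \<rho>: "germ_param f \<rho>" and "fps_nth (\<rho> g) 0 = 0" "fps_nth (\<rho> g) 1 = 0" "fps_nth (\<rho> g) 2 \<noteq> 0"
  shows "intersection_number (multiples f) (multiples g) = 2"
proof -
  have hom: "comm_ring_hom \<rho>" and const: "\<And>c. \<rho> (const_fps2 c) = fps_const c" and "surj \<rho>"
    using \<rho> by (auto simp: germ_param_def)
  note [simp] = comm_ring_homD[OF hom] comm_ring_hom_more[OF hom] const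
  define J where "J = {h. fps_nth (\<rho> h) 0 = 0 \<and> fps_nth (\<rho> h) 1 = 0}"
  have J: "{h. \<forall>n<2. fps_nth (\<rho> h) n = 0} = J" by (auto simp: J_def less_2_cases_iff)
  have "{x + y | x y. x \<in> multiples f \<and> y \<in> multiples g} = {h. \<forall>n<2. fps_nth (\<rho> h) n = 0}"
    by (rule intersection_ideal[OF \<rho>]) (use assms in \<open>auto simp: less_2_cases_iff\<close>)
  moreover have "codim J = 2"
    unfolding codim_def
  proof (rule antisym)
    \<comment> \<open>\<open>e\<close> restricts to the parameter of the curve; \<open>1\<close> and
      \<open>e\<close> span the functions modulo order two.\<close>
    obtain e where e: "\<rho> e = fps_X" using \<open>surj \<rho>\<close> by (metis surjD)
    then have "1 \<noteq> e" by (metis comm_ring_homD(2)[OF hom] fps_X_neq_one)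
    show "Inf {enat (card B) | B. finite B \<and> (\<forall>f. \<exists>c. f - (\<Sum>b\<in>B. const_fps2 (c b) * b) \<in> J)} \<le> 2"
    proof (rule Inf_lower, intro CollectI exI[of _ "{1, e}"] conjI allI)
      fix f
      show "\<exists>c. f - (\<Sum>b\<in>{1, e}. const_fps2 (c b) * b) \<in> J"
        using \<open>1 \<noteq> e\<close>
        by (intro exI[of _ "\<lambda>b. fps_nth (\<rho> f) (if b = e then 1 else 0)"]) (simp add: J_def e)
    qed (use \<open>1 \<noteq> e\<close> in \<open>auto simp: numeral_eq_enat\<close>)
    show "2 \<le> Inf {enat (card B) | B. finite B \<and> (\<forall>f. \<exists>c. f - (\<Sum>b\<in>B. const_fps2 (c b) * b) \<in> J)}"
    proof (rule Inf_greatest, safe)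
      fix B :: "fps2 set"
      assume B: "finite B" "\<forall>f. \<exists>c. f - (\<Sum>b\<in>B. const_fps2 (c b) * b) \<in> J"
      obtain c where c: "1 - (\<Sum>b\<in>B. const_fps2 (c b) * b) \<in> J" using B(2) by blast
      obtain d where d: "e - (\<Sum>b\<in>B. const_fps2 (d b) * b) \<in> J" using B(2) by blast
      have "\<not> card B \<le> 1"
      proof
        assume "card B \<le> 1"
        then consider "B = {}" | b where "B = {b}"
          using B(1) by (metis card_1_singletonE card_eq_0_iff le_neq_implies_less less_one)
        then show False
        proof cases
          case 1
          then show ?thesis using c by (simp add: J_def)
        next
          case (2 b)
          \<comment> \<open>The multiples of a single \<open>b\<close> would represent both
            \<open>1\<close> and \<open>e\<close>: the first equation gives
            \<open>c b \<noteq> 0\<close>, the second then kills the linear coefficient of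
            \<open>\<rho> b\<close>, and the third contradicts this.\<close>
          have "c b * fps_nth (\<rho> b) 0 = 1" "c b * fps_nth (\<rho> b) 1 = 0" "d b * fps_nth (\<rho> b) 1 = 1"
            using c d by (simp_all add: 2 J_def e)
          then show ?thesis by auto
        qed
      qed
      then show "2 \<le> enat (card B)" by (simp add: numeral_eq_enat)
    qed
  qed
  ultimately show ?thesis by (simp only: intersection_number_def J)
qed

lemma intersection_number_transversal:
  assumes "const_term f = 0" "const_term g = 0"
    "fst (linear_part f) * snd (linear_part g) \<noteq> snd (linear_part f) * fst (linear_part g)"
  shows "intersection_number (multiples f) (multiples g) = 1"
proof -
  obtain a b c d where lin: "linear_part f = (a, b)" "linear_part g = (c, d)" by fastforce
  have "linear_part f \<noteq> (0, 0)" using assms(3) by auto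
  then obtain \<rho> where \<rho>: "germ_param f \<rho>" using germ_param_exists assms(1) by blast
  then obtain x y where xy: "(x, y) \<noteq> (0, 0)" "x * a + y * b = 0"
      "\<And>g. fps_nth (\<rho> g) 1 = x * fst (linear_part g) + y * snd (linear_part g)"
    unfolding germ_param_def lin by auto
  have "x * c + y * d \<noteq> 0"
  proof
    assume *: "x * c + y * d = 0"
    \<comment> \<open>Cramer's rule: a nonzero vector killed by both linear parts makes their
      determinant vanish.\<close>
    have "x * (a * d - b * c) = d * (x * a + y * b) - b * (x * c + y * d)"
      "y * (a * d - b * c) = a * (x * c + y * d) - c * (x * a + y * b)"
      by (simp_all add: algebra_simps)
    then show False using xy(1,2) * assms(3) lin by auto
  qed
  then have "fps_nth (\<rho> g) 1 \<noteq> 0" using xy(3) lin by simp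
  then show ?thesis using intersection_number_eq_1[OF \<rho>] assms(2) by blast
qed

section \<open>Lines and conics\<close>

definition dot :: "complex^3 \<Rightarrow> complex^3 \<Rightarrow> complex" where
  "dot l v = l $ 1 * v $ 1 + l $ 2 * v $ 2 + l $ 3 * v $ 3"

text \<open>Only the entries of \<open>M\<close> on and above the diagonal are used.\<close>

definition qval :: "complex^3^3 \<Rightarrow> complex^3 \<Rightarrow> complex" where
  "qval M v = M$1$1 * (v$1 * v$1) + M$2$2 * (v$2 * v$2) + M$3$3 * (v$3 * v$3)
     + M$1$2 * (v$1 * v$2) + M$1$3 * (v$1 * v$3) + M$2$3 * (v$2 * v$3)"

definition qgrad :: "complex^3^3 \<Rightarrow> complex^3 \<Rightarrow> complex^3" where
  "qgrad M v = vector [2 * M$1$1 * v$1 + M$1$2 * v$2 + M$1$3 * v$3,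
     M$1$2 * v$1 + 2 * M$2$2 * v$2 + M$2$3 * v$3, M$1$3 * v$1 + M$2$3 * v$2 + 2 * M$3$3 * v$3]"

definition lform :: "complex^3 \<Rightarrow> poly3" where
  "lform l = pCons [:[:0, l$1:], [:l$2:]:] [:[:[:l$3:]:]:]"

definition qform :: "complex^3^3 \<Rightarrow> poly3" where
  "qform M = pCons (pCons [:0, 0, M$1$1:] (pCons [:0, M$1$2:] [:[:M$2$2:]:]))
     (pCons (pCons [:0, M$1$3:] [:[:M$2$3:]:]) [:[:[:M$3$3:]:]:])"

text \<open>The polar form without the factor 1/2, that is, the mixed term of
  \<open>qval M (v + w)\<close>. Written as a gradient paired with a vector, it lets lines and
  tangent lines of conics be treated alike as covectors.\<close>

abbreviation bil :: "complex^3^3 \<Rightarrow> complex^3 \<Rightarrow> complex^3 \<Rightarrow> complex" where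
  "bil M v \<equiv> dot (qgrad M v)"

lemma dot_add_right: "dot l (v + w) = dot l v + dot l w"
  by (simp add: dot_def algebra_simps)

lemma dot_scale_right: "dot l (c *s v) = c * dot l v"
  by (simp add: dot_def algebra_simps)

lemma dot_add_left: "dot (l + m) v = dot l v + dot m v"
  by (simp add: dot_def algebra_simps)

lemma dot_scale_left: "dot (c *s l) v = c * dot l v"
  by (simp add: dot_def algebra_simps)

lemma dot_commute: "dot l v = dot v l"
  by (simp add: dot_def algebra_simps)

lemma dot_0 [simp]: "dot 0 v = 0" "dot l 0 = 0"
  by (simp_all add: dot_def)

lemma qgrad_add: "qgrad M (v + w) = qgrad M v + qgrad M w"
  by (simp add: vec_eq_iff forall_3 qgrad_def algebra_simps)

lemma qgrad_scale: "qgrad M (c *s v) = c *s qgrad M v"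
  by (simp add: vec_eq_iff forall_3 qgrad_def algebra_simps)

lemma bil_commute: "bil M v w = bil M w v"
  by (simp add: dot_def qgrad_def algebra_simps)

lemma bil_self: "bil M v v = 2 * qval M v"
  by (simp add: dot_def qgrad_def qval_def algebra_simps)

lemma qval_add: "qval M (v + w) = qval M v + qval M w + bil M v w"
  by (simp add: dot_def qgrad_def qval_def algebra_simps)

lemma qval_scale: "qval M (c *s v) = c\<^sup>2 * qval M v"
  by (simp add: qval_def algebra_simps power2_eq_square)

lemmas form_simps = dot_add_right dot_scale_right dot_add_left dot_scale_left qgrad_add qgrad_scale
  qval_add qval_scale

text \<open>Vectors and covectors are not distinguished, so the same product gives the common point
  of two lines and the line through two points.\<close>

definition vcross :: "complex^3 \<Rightarrow> complex^3 \<Rightarrow> complex^3" where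
  "vcross a b = vector [a$2 * b$3 - a$3 * b$2, a$3 * b$1 - a$1 * b$3, a$1 * b$2 - a$2 * b$1]"

lemma dot_vcross: "dot a (vcross a b) = 0" "dot b (vcross a b) = 0"
  by (simp_all add: dot_def vcross_def algebra_simps)

lemma vcross_eq_0D:
  assumes "vcross a b = 0" "a \<noteq> 0"
  shows "\<exists>c. b = c *s a"
proof -
  have eq: "a$2 * b$3 = a$3 * b$2" "a$3 * b$1 = a$1 * b$3" "a$1 * b$2 = a$2 * b$1"
    using assms(1) by (simp_all add: vcross_def vec_eq_iff forall_3)
  consider "a$1 \<noteq> 0" | "a$2 \<noteq> 0" | "a$3 \<noteq> 0" using assms(2) vec3_eq_0_iff by blast
  then show ?thesis
  proof cases
    case 1
    then show ?thesis
      using eq by (intro exI[of _ "b$1 / a$1"]) (simp add: vec_eq_iff forall_3 field_simps)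
  next
    case 2
    then show ?thesis
      using eq by (intro exI[of _ "b$2 / a$2"]) (simp add: vec_eq_iff forall_3 field_simps)
  next
    case 3
    then show ?thesis
      using eq by (intro exI[of _ "b$3 / a$3"]) (simp add: vec_eq_iff forall_3 field_simps)
  qed
qed

lemma vcross_span:
  assumes "vcross a b \<noteq> 0" "dot a v = 0" "dot b v = 0"
  shows "\<exists>c. v = c *s vcross a b"
proof -
  \<comment> \<open>The triple product expansion; both terms vanish, which leaves \<open>v\<close>
    parallel to \<open>vcross a b\<close>.\<close>
  have "vcross (vcross a b) v = dot a v *s b + (- dot b v) *s a"
    by (simp add: vec_eq_iff forall_3 vcross_def dot_def algebra_simps)
  also have "\<dots> = 0" using assms by simp
  finally show ?thesis using vcross_eq_0D assms(1) by blast
qed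

lemma two_points_on_line:
  assumes "l \<noteq> 0"
  shows "\<exists>p w. dot l p = 0 \<and> dot l w = 0 \<and> p \<noteq> 0 \<and> (\<forall>c. w \<noteq> c *s p)"
proof -
  consider "l$1 \<noteq> 0" | "l$2 \<noteq> 0" | "l$3 \<noteq> 0" using assms vec3_eq_0_iff by blast
  then show ?thesis
  proof cases
    case 1
    then show ?thesis
      by (intro exI[of _ "vector [- l$2, l$1, 0] :: complex^3"]
          exI[of _ "vector [- l$3, 0, l$1] :: complex^3"])
        (auto simp: dot_def vec_eq_iff forall_3)
  next
    case 2
    then show ?thesis
      by (intro exI[of _ "vector [l$2, - l$1, 0] :: complex^3"]
          exI[of _ "vector [0, - l$3, l$2] :: complex^3"])
        (auto simp: dot_def vec_eq_iff forall_3)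
  next
    case 3
    then show ?thesis
      by (intro exI[of _ "vector [l$3, 0, - l$1] :: complex^3"]
          exI[of _ "vector [0, l$3, - l$2] :: complex^3"])
        (auto simp: dot_def vec_eq_iff forall_3)
  qed
qed

section \<open>Equations and local equations of lines and conics\<close>

lemma is_line_lform:
  assumes "is_line D"
  obtains l where "l \<noteq> 0" "D = lform l"
proof -
  let ?c = "\<lambda>k j i. coeff (coeff (coeff D k) j) i"
  have hom: "?c k j i = 0" if "i + j + k \<noteq> 1" for i j k
    using assms that by (auto simp: is_line_def homogeneous_def)
  define l :: "complex^3" where "l = vector [?c 0 0 1, ?c 0 1 0, ?c 1 0 0]"
  have "D = lform l"
    unfolding lform_def l_def
    by (intro poly_eqI) (auto simp: coeff_pCons hom split: nat.splits)
  moreover have "l \<noteq> 0" using calculation assms by (auto simp: is_line_def lform_def)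
  ultimately show thesis using that by blast
qed

lemma homogeneous_2_qform:
  assumes "homogeneous 2 D"
  obtains M where "D = qform M"
proof -
  let ?c = "\<lambda>k j i. coeff (coeff (coeff D k) j) i"
  have hom: "?c k j i = 0" if "i + j + k \<noteq> 2" for i j k
    using assms that by (auto simp: homogeneous_def)
  define M :: "complex^3^3" where "M = vector [vector [?c 0 0 2, ?c 0 1 1, ?c 1 0 1],
     vector [0, ?c 0 2 0, ?c 1 1 0], vector [0, 0, ?c 2 0 0]]"
  have "D = qform M"
    unfolding qform_def M_def
    by (intro poly_eqI) (auto simp: coeff_pCons hom numeral_2_eq_2 split: nat.splits)
  then show thesis using that by blast
qed

lemma eval3_lform:
  assumes "comm_ring_hom h"
  shows "eval3 h (lform l) x y z = h (l$1) * x + h (l$2) * y + h (l$3) * z"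
  by (simp add: eval3_def lform_def map_poly_pCons comm_ring_homD[OF assms] algebra_simps)

lemma eval3_qform:
  assumes "comm_ring_hom h"
  shows "eval3 h (qform M) x y z = h (M$1$1) * (x * x) + h (M$2$2) * (y * y) + h (M$3$3) * (z * z)
    + h (M$1$2) * (x * y) + h (M$1$3) * (x * z) + h (M$2$3) * (y * z)"
  by (simp add: eval3_def qform_def map_poly_pCons comm_ring_homD[OF assms] algebra_simps)

lemma on_curve_lform: "on_curve (lform l) P \<longleftrightarrow> dot l (rep_proj_plane P) = 0"
  by (simp add: on_curve_def eval3_lform comm_ring_hom_id dot_def Let_def)

lemma on_curve_qform: "on_curve (qform M) P \<longleftrightarrow> qval M (rep_proj_plane P) = 0"
  by (simp add: on_curve_def eval3_qform comm_ring_hom_id qval_def Let_def)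

lemma local_eq_lform:
  fixes P :: proj_plane
  defines "v \<equiv> rep_proj_plane P"
  shows "local_eq (lform l) P = const_fps2 (dot l v) + const_fps2 (dot l (chart1 v)) * fps_const fps_X
    + const_fps2 (dot l (chart2 v)) * fps_X"
  by (simp add: local_eq_eq Let_def eval3_lform comm_ring_hom_const_fps2 affine_coord_def dot_def
      comm_ring_homD[OF comm_ring_hom_const_fps2] algebra_simps flip: v_def)

text \<open>The Taylor expansion of the form at \<open>v\<close> in the two chart directions, which
  stops at order two.\<close>

lemma local_eq_qform:
  fixes P :: proj_plane
  defines "v \<equiv> rep_proj_plane P"
  shows "local_eq (qform M) P = const_fps2 (qval M v) + const_fps2 (bil M v (chart1 v)) * fps_const fps_X
    + const_fps2 (bil M v (chart2 v)) * fps_X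
    + const_fps2 (qval M (chart1 v)) * (fps_const fps_X * fps_const fps_X)
    + const_fps2 (bil M (chart1 v) (chart2 v)) * (fps_const fps_X * fps_X)
    + const_fps2 (qval M (chart2 v)) * (fps_X * fps_X)"
proof -
  define k where "k = const_fps2"
  define s t :: fps2 where "s = fps_const fps_X" and "t = fps_X"
  define d e where "d = chart1 v" and "e = chart2 v"
  have hom: "comm_ring_hom k" by (simp add: k_def comm_ring_hom_const_fps2)
  \<comment> \<open>\<open>E\<close> stores a polynomial of degree at most two in \<open>s\<close>
    and \<open>t\<close> by its six complex coefficients, so the identity of power series reduces to
    identities of numbers.\<close>
  define E where "E c0 c1 c2 c3 c4 c5 = k c0 + k c1 * s + k c2 * t + k c3 * (s * s) + k c4 * (s * t)
      + k c5 * (t * t)" for c0 c1 c2 c3 c4 c5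
  note homs = comm_ring_homD[OF hom]
  have E_add: "E a0 a1 a2 a3 a4 a5 + E b0 b1 b2 b3 b4 b5 =
      E (a0 + b0) (a1 + b1) (a2 + b2) (a3 + b3) (a4 + b4) (a5 + b5)"
    for a0 a1 a2 a3 a4 a5 b0 b1 b2 b3 b4 b5
    by (simp add: E_def homs algebra_simps)
  have E_scale: "k c * E a0 a1 a2 a3 a4 a5 = E (c * a0) (c * a1) (c * a2) (c * a3) (c * a4) (c * a5)"
    for c a0 a1 a2 a3 a4 a5
    by (simp add: E_def homs algebra_simps)
  have prod: "(k a + k b * s + k c * t) * (k a' + k b' * s + k c' * t) =
      E (a * a') (a * b' + b * a') (a * c' + c * a') (b * b') (b * c' + c * b') (c * c')"
    for a b c a' b' c'
    by (simp add: E_def homs algebra_simps)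
  have "local_eq (qform M) P = eval3 k (qform M) (k (v$1) + k (d$1) * s + k (e$1) * t)
      (k (v$2) + k (d$2) * s + k (e$2) * t) (k (v$3) + k (d$3) * s + k (e$3) * t)"
    by (simp only: local_eq_eq Let_def affine_coord_def v_def k_def s_def t_def d_def e_def)
  also have "\<dots> = E (qval M v) (bil M v d) (bil M v e) (qval M d) (bil M d e) (qval M e)"
    unfolding eval3_qform[OF hom] prod E_add E_scale qval_def
    by (simp add: dot_def qgrad_def algebra_simps)
  finally show ?thesis by (simp only: E_def v_def k_def s_def t_def d_def e_def)
qed

lemma const_term_mult: "const_term (f * g) = const_term f * const_term g"
  using comm_ring_hom_const_term by (simp add: comm_ring_hom_def)

lemma const_term_add: "const_term (f + g) = const_term f + const_term g"
  using comm_ring_hom_const_term by (simp add: comm_ring_hom_def)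

lemma local_eq_lform_parts:
  fixes P :: proj_plane
  defines "v \<equiv> rep_proj_plane P"
  shows "const_term (local_eq (lform l) P) = dot l v"
    "linear_part (local_eq (lform l) P) = (dot l (chart1 v), dot l (chart2 v))"
  unfolding local_eq_lform v_def
  by (simp_all add: const_term_add const_term_mult linear_part_add linear_part_mult linear_part_vars)

lemma local_eq_qform_parts:
  fixes P :: proj_plane
  defines "v \<equiv> rep_proj_plane P"
  shows "const_term (local_eq (qform M) P) = qval M v"
    "linear_part (local_eq (qform M) P) = (bil M v (chart1 v), bil M v (chart2 v))"
  unfolding local_eq_qform v_def
  by (simp_all add: const_term_add const_term_mult linear_part_add linear_part_mult linear_part_vars
      del: fps_const_mult)

section \<open>Points, representatives and smooth conics\<close>

lemma rep_proj_plane_nonzero: "rep_proj_plane P \<noteq> 0"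
  using Quotient3_rep_reflp[OF Quotient3_proj_plane, of P] by (simp add: proj_rel_def)

lemma proj_plane_eqI:
  assumes "rep_proj_plane P = c *s rep_proj_plane Q"
  shows "P = Q"
proof -
  have "c \<noteq> 0" using assms rep_proj_plane_nonzero[of P] by auto
  then have "proj_rel (rep_proj_plane Q) (rep_proj_plane P)"
    using assms rep_proj_plane_nonzero by (auto simp: proj_rel_def)
  then show ?thesis
    using Quotient3_rel_rep[OF Quotient3_proj_plane] by metis
qed

text \<open>Linear algebra produces a vector, whereas \<open>rep_proj_plane\<close> makes its own
  choice of representative; the two differ by the factor \<open>c\<close>, which homogeneous
  conditions ignore.\<close>

lemma proj_plane_exists:
  assumes "v \<noteq> 0"
  obtains P c where "c \<noteq> 0" "rep_proj_plane P = c *s v"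
proof -
  have "proj_rel v v" using assms by (auto simp: proj_rel_def intro!: exI[of _ 1])
  then have "proj_rel v (rep_proj_plane (abs_proj_plane v))"
    using Quotient3_rep_abs[OF Quotient3_proj_plane] part_equivp_proj_rel part_equivp_symp by metis
  then show thesis using that by (auto simp: proj_rel_def)
qed

definition nondegenerate :: "complex^3^3 \<Rightarrow> bool" where
  "nondegenerate M \<longleftrightarrow> (\<forall>v. v \<noteq> 0 \<longrightarrow> qval M v = 0 \<longrightarrow> qgrad M v \<noteq> 0)"

lemma is_smooth_conic_qform:
  assumes "is_smooth_conic D"
  obtains M where "D = qform M" "nondegenerate M"
proof -
  obtain M where D: "D = qform M"
    using assms homogeneous_2_qform by (auto simp: is_smooth_conic_def)
  have "qgrad M v \<noteq> 0" if v: "v \<noteq> 0" "qval M v = 0" for v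
  proof
    assume 0: "qgrad M v = 0"
    obtain P c where P: "c \<noteq> 0" "rep_proj_plane P = c *s v" using proj_plane_exists v(1) by blast
    have "on_curve D P" using P v by (simp add: D on_curve_qform form_simps)
    moreover have "const_term (local_eq D P) = 0" "linear_part (local_eq D P) = (0, 0)"
      using P v 0 by (simp_all add: D local_eq_qform_parts form_simps)
    ultimately have "P \<in> Sing D" by (simp add: Sing_def germ_def smooth_germ_multiples)
    then show False using assms by (simp add: is_smooth_conic_def)
  qed
  then show thesis using that D by (auto simp: nondegenerate_def)
qed

text \<open>The form vanishes on the whole line through \<open>p\<close> and \<open>w\<close>. The
  gradients at both points then annihilate that line, so both are multiples of
  \<open>vcross p w\<close>, and some nonzero combination of \<open>p\<close> and \<open>w\<close>
  has gradient zero: a singular point of the conic.\<close>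

lemma nondegenerate_no_line:
  assumes M: "nondegenerate M" and "p \<noteq> 0" "\<forall>c. w \<noteq> c *s p"
    and "qval M p = 0" "bil M p w = 0" "qval M w = 0"
  shows False
proof -
  have n: "vcross p w \<noteq> 0" using vcross_eq_0D assms(2,3) by blast
  have "\<exists>a. qgrad M p = a *s vcross p w"
    using assms by (intro vcross_span[OF n]) (simp_all add: dot_commute[of _ "qgrad M p"] bil_self)
  then obtain a where a: "qgrad M p = a *s vcross p w" by blast
  have "\<exists>b. qgrad M w = b *s vcross p w"
    using assms by (intro vcross_span[OF n])
      (simp_all add: dot_commute[of _ "qgrad M w"] bil_self bil_commute[of M w p])
  then obtain b where b: "qgrad M w = b *s vcross p w" by blast
  have "a \<noteq> 0" using M assms a by (auto simp: nondegenerate_def)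
  define v where "v = b *s p + (- a) *s w"
  have "qgrad M v = 0"
    unfolding v_def qgrad_add qgrad_scale a b by (simp add: vec_eq_iff)
  moreover have "qval M v = 0"
    unfolding v_def qval_add qval_scale qgrad_scale dot_scale_left dot_scale_right
    using assms by simp
  moreover have "v \<noteq> 0"
  proof
    assume "v = 0"
    then have "a *s w = b *s p" by (simp add: v_def vec_eq_iff forall_3)
    then have "w = (b / a) *s p" using \<open>a \<noteq> 0\<close> by (simp add: vec_eq_iff forall_3 field_simps)
    then show False using assms(3) by blast
  qed
  ultimately show False using M by (auto simp: nondegenerate_def)
qed

text \<open>The germs at \<open>P\<close>, when smooth, have the same tangent line.\<close>

definition tangent_at :: "poly3 \<Rightarrow> poly3 \<Rightarrow> proj_plane \<Rightarrow> bool" where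
  "tangent_at D E P \<longleftrightarrow>
     fst (linear_part (local_eq D P)) * snd (linear_part (local_eq E P)) =
     snd (linear_part (local_eq D P)) * fst (linear_part (local_eq E P))"

definition is_component :: "poly3 \<Rightarrow> bool" where
  "is_component D \<longleftrightarrow> is_line D \<or> is_smooth_conic D"

lemma covector_nonzero:
  assumes "\<And>v. dot g v = 0"
  shows "g = 0"
  using assms[of "axis 1 1"] assms[of "axis 2 1"] assms[of "axis 3 1"] three_neq
  by (simp add: dot_def axis_def vec3_eq_0_iff)

lemma covector_eq_0:
  assumes "v \<noteq> 0" "dot g v = 0" "dot g (chart1 v) = 0" "dot g (chart2 v) = 0"
  shows "g = 0"
proof -
  have *: "dot g w = 0" for w
    by (rule chart_span[OF assms(1), of w]) (simp add: form_simps assms)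
  then show ?thesis by (rule covector_nonzero)
qed

text \<open>The covector of the component, a line or the gradient of a conic, kills the
  representative \<open>v\<close>; for conics this is Euler's relation \<open>bil_self\<close>. If
  it also killed both chart vectors it would be zero.\<close>

lemma component_local_eq:
  assumes "is_component D" "on_curve D P"
  shows "const_term (local_eq D P) = 0" "linear_part (local_eq D P) \<noteq> (0, 0)"
proof -
  let ?v = "rep_proj_plane P"
  have "const_term (local_eq D P) = 0 \<and> linear_part (local_eq D P) \<noteq> (0, 0)"
  proof (cases "is_line D")
    case True
    then obtain l where "l \<noteq> 0" "D = lform l" by (rule is_line_lform)
    then show ?thesis
      using assms covector_eq_0[OF rep_proj_plane_nonzero, of l P]
      by (auto simp: on_curve_lform local_eq_lform_parts)
  next
    case False
    then obtain M where M: "D = qform M" "nondegenerate M"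
      using assms is_smooth_conic_qform by (auto simp: is_component_def)
    then have "qval M ?v = 0" using assms by (simp add: on_curve_qform)
    moreover have "qgrad M ?v \<noteq> 0"
      using calculation M rep_proj_plane_nonzero by (auto simp: nondegenerate_def)
    ultimately show ?thesis
      using M covector_eq_0[OF rep_proj_plane_nonzero, of "qgrad M ?v" P]
      by (auto simp: local_eq_qform_parts bil_self)
  qed
  then show "const_term (local_eq D P) = 0" "linear_part (local_eq D P) \<noteq> (0, 0)" by auto
qed

lemma component_local_eq_unit:
  assumes "is_component D" "\<not> on_curve D P"
  shows "const_term (local_eq D P) \<noteq> 0"
proof (cases "is_line D")
  case True
  then show ?thesis
    using assms by (auto elim!: is_line_lform simp: on_curve_lform local_eq_lform_parts)
next
  case False
  then obtain M where M: "D = qform M" "nondegenerate M"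
    using assms is_smooth_conic_qform by (auto simp: is_component_def)
  then show ?thesis using assms by (simp add: on_curve_qform local_eq_qform_parts)
qed

text \<open>A covector that kills \<open>v\<close> is determined by its values on the chart vectors.
  The last hypothesis is the determinant condition of \<open>tangent_at\<close>, so this is how
  geometric information is drawn from a tangency.\<close>

lemma covector_proportional:
  assumes "v \<noteq> 0" "dot g v = 0" "dot h v = 0" "g \<noteq> 0"
    and "dot g (chart1 v) * dot h (chart2 v) = dot g (chart2 v) * dot h (chart1 v)"
  shows "\<exists>c. h = c *s g"
proof -
  let ?a = "dot g (chart1 v)" and ?b = "dot g (chart2 v)"
  have "?a \<noteq> 0 \<or> ?b \<noteq> 0" using covector_eq_0 assms by blast
  then have "\<exists>c. dot h (chart1 v) = c * ?a \<and> dot h (chart2 v) = c * ?b"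
  proof
    assume "?a \<noteq> 0"
    then show ?thesis
      using assms(5) by (intro exI[of _ "dot h (chart1 v) / ?a"]) (simp add: field_simps)
  next
    assume "?b \<noteq> 0"
    then show ?thesis
      using assms(5) by (intro exI[of _ "dot h (chart2 v) / ?b"]) (simp add: field_simps)
  qed
  then obtain c where c: "dot h (chart1 v) = c * ?a" "dot h (chart2 v) = c * ?b" by blast
  have "h + (- c) *s g = 0"
    by (rule covector_eq_0[OF assms(1)], unfold dot_add_left dot_scale_left) (simp_all add: c assms)
  then have "h = c *s g" by (simp add: vec_eq_iff forall_3)
  then show ?thesis by blast
qed

text \<open>The way to establish a tangency: a second common zero \<open>w\<close>, independent of
  \<open>v\<close>, has chart components that give a nonzero kernel vector of the matrix of values,
  so its determinant vanishes.\<close>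

lemma covectors_common_zero:
  assumes "v \<noteq> 0" "dot g v = 0" "dot h v = 0" "dot g w = 0" "dot h w = 0" "\<forall>c. w \<noteq> c *s v"
  shows "dot g (chart1 v) * dot h (chart2 v) = dot g (chart2 v) * dot h (chart1 v)"
proof -
  obtain \<alpha> \<beta> \<gamma> where w: "w = \<alpha> *s v + \<beta> *s chart1 v + \<gamma> *s chart2 v"
    using chart_span[OF assms(1)] by blast
  have nz: "\<beta> \<noteq> 0 \<or> \<gamma> \<noteq> 0" using assms(6) w by auto
  let ?a = "dot g (chart1 v)" and ?b = "dot g (chart2 v)"
  let ?c = "dot h (chart1 v)" and ?d = "dot h (chart2 v)"
  have e: "\<beta> * ?a + \<gamma> * ?b = 0" "\<beta> * ?c + \<gamma> * ?d = 0"
    using assms by (simp_all add: w form_simps)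
  have "\<beta> * (?a * ?d - ?b * ?c) = ?d * (\<beta> * ?a + \<gamma> * ?b) - ?b * (\<beta> * ?c + \<gamma> * ?d)"
    "\<gamma> * (?a * ?d - ?b * ?c) = ?a * (\<beta> * ?c + \<gamma> * ?d) - ?c * (\<beta> * ?a + \<gamma> * ?b)"
    by (simp_all add: algebra_simps)
  then show ?thesis using e nz by auto
qed

section \<open>Intersections of lines and conics\<close>

lemma tangent_at_commute: "tangent_at D E P \<longleftrightarrow> tangent_at E D P"
  unfolding tangent_at_def by (metis mult.commute)

lemma intersection_number_commute: "intersection_number I J = intersection_number J I"
proof -
  have "{f + g | f g. f \<in> I \<and> g \<in> J} = {f + g | f g. f \<in> J \<and> g \<in> I}"
    by (intro Collect_cong) (metis add.commute)
  then show ?thesis by (simp add: intersection_number_def)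
qed

lemma const3_hom:
  "const3 (x * y) = const3 x * const3 y" "const3 (x - y) = const3 x - const3 y" "const3 (- x) = - const3 x"
  by (simp_all add: const3_def)

lemma const3_unit: "c \<noteq> 0 \<Longrightarrow> const3 c dvd 1"
  by (simp add: const3_def is_unit_const_poly_iff dvd_field_iff)

lemma lform_scale: "lform (c *s l) = const3 c * lform l"
  by (simp add: lform_def const3_def)

lemma normalize_lform_scale:
  assumes "c \<noteq> 0"
  shows "normalize (lform (c *s l)) = normalize (lform l)"
  using const3_unit[OF assms] by (simp add: lform_scale normalize_mult_unit_left)

lemma tangent_lines_eq:
  assumes "is_line L" "is_line L'" "on_curve L P" "on_curve L' P" "tangent_at L L' P"
  shows "normalize L = normalize L'"
proof -
  obtain l l' where l: "l \<noteq> 0" "L = lform l" "l' \<noteq> 0" "L' = lform l'"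
    using assms is_line_lform by metis
  then obtain c where "l' = c *s l"
    using covector_proportional[OF rep_proj_plane_nonzero, of l P l'] assms
    by (auto simp: on_curve_lform tangent_at_def local_eq_lform_parts)
  then show ?thesis using l normalize_lform_scale[of c l] by auto
qed

lemma lines_meet:
  assumes "is_line L" "is_line L'"
  shows "\<exists>P. on_curve L P \<and> on_curve L' P"
proof -
  obtain l l' where l: "l \<noteq> 0" "L = lform l" "l' \<noteq> 0" "L' = lform l'"
    using assms is_line_lform by metis
  have "\<exists>v. v \<noteq> 0 \<and> dot l v = 0 \<and> dot l' v = 0"
  proof (cases "vcross l l' = 0")
    case True
    then obtain c where c: "l' = c *s l" using vcross_eq_0D l by blast
    obtain p where "dot l p = 0" "p \<noteq> 0" using two_points_on_line l(1) by blast
    then show ?thesis using c by (intro exI[of _ p]) (simp add: dot_scale_left)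
  qed (use dot_vcross in blast)
  then obtain v where v: "v \<noteq> 0" "dot l v = 0" "dot l' v = 0" by blast
  obtain P c where "rep_proj_plane P = c *s v" using proj_plane_exists v(1) by blast
  then show ?thesis using v l by (intro exI[of _ P]) (simp add: on_curve_lform dot_scale_right)
qed

text \<open>A second common point would make the lines tangent at the first one, and tangent lines
  coincide.\<close>

lemma lines_meet_unique:
  assumes "is_line L" "is_line L'" "normalize L \<noteq> normalize L'"
    "on_curve L P" "on_curve L' P" "on_curve L P'" "on_curve L' P'"
  shows "P = P'"
proof (rule ccontr)
  assume "P \<noteq> P'"
  then have "\<forall>c. rep_proj_plane P' \<noteq> c *s rep_proj_plane P" using proj_plane_eqI by metis
  moreover obtain l l' where l: "L = lform l" "L' = lform l'"
    using assms is_line_lform by metis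
  ultimately have "tangent_at L L' P"
    using covectors_common_zero[OF rep_proj_plane_nonzero, of l P l' "rep_proj_plane P'"] assms
    by (auto simp: on_curve_lform tangent_at_def local_eq_lform_parts)
  then show False using tangent_lines_eq assms by blast
qed

lemma line_conic_meet:
  assumes "is_line L" "is_smooth_conic Q"
  shows "\<exists>P. on_curve L P \<and> on_curve Q P"
proof -
  obtain l where l: "l \<noteq> 0" "L = lform l" using assms is_line_lform by metis
  obtain M where M: "Q = qform M" using assms is_smooth_conic_qform by metis
  obtain p w where pw: "dot l p = 0" "dot l w = 0" "p \<noteq> 0" "\<forall>c. w \<noteq> c *s p"
    using two_points_on_line[OF l(1)] by blast
  have "\<exists>v. v \<noteq> 0 \<and> dot l v = 0 \<and> qval M v = 0"
  proof (cases "qval M p = 0")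
    case False
    \<comment> \<open>The polynomial is the form restricted to \<open>x *s p + w\<close>. It has a
      root because its leading coefficient is nonzero; otherwise \<open>p\<close> itself is a common
      point.\<close>
    have "degree [:qval M w, bil M p w, qval M p:] = 2" using False by simp
    then have "\<exists>x. poly [:qval M w, bil M p w, qval M p:] x = 0"
      by (intro alg_closed_imp_poly_has_root) simp
    then obtain x where x: "qval M w + x * (bil M p w + x * qval M p) = 0" by auto
    have "qval M (x *s p + w) = 0"
      using x by (simp add: form_simps bil_commute[of M w p] power2_eq_square algebra_simps)
    moreover have "x *s p + w \<noteq> 0"
    proof
      assume "x *s p + w = 0"
      then have "w = (- x) *s p" by (simp add: vec_eq_iff eq_neg_iff_add_eq_0 add.commute)
      then show False using pw(4) by blast
    qed
    ultimately show ?thesis using pw by (intro exI[of _ "x *s p + w"]) (simp add: form_simps)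
  qed (use pw in blast)
  then obtain v where v: "v \<noteq> 0" "dot l v = 0" "qval M v = 0" by blast
  obtain P c where "rep_proj_plane P = c *s v" using proj_plane_exists v(1) by blast
  then show ?thesis
    using v l M by (intro exI[of _ P]) (simp add: on_curve_lform on_curve_qform form_simps)
qed

lemma tangent_line_conic_gradient:
  assumes "l \<noteq> 0" "on_curve (lform l) P" "on_curve (qform M) P" "tangent_at (lform l) (qform M) P"
  obtains k where "qgrad M (rep_proj_plane P) = k *s l"
proof -
  have "\<exists>k. qgrad M (rep_proj_plane P) = k *s l"
    using assms
    by (intro covector_proportional[OF rep_proj_plane_nonzero, of l P])
      (auto simp: on_curve_lform on_curve_qform bil_self tangent_at_def local_eq_lform_parts
        local_eq_qform_parts)
  then show thesis using that by blast
qed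

text \<open>At a tangency the gradient of the conic is a multiple of the line. A second common point
  would then be polar to the first, and the conic would contain the whole line.\<close>

lemma tangent_line_meets_once:
  assumes "is_line L" "is_smooth_conic Q" "on_curve L P" "on_curve Q P" "tangent_at L Q P"
    "on_curve L P'" "on_curve Q P'"
  shows "P' = P"
proof (rule ccontr)
  assume "P' \<noteq> P"
  then have ne: "\<forall>c. rep_proj_plane P' \<noteq> c *s rep_proj_plane P" using proj_plane_eqI by metis
  obtain l where l: "l \<noteq> 0" "L = lform l" using assms is_line_lform by metis
  obtain M where M: "Q = qform M" "nondegenerate M" using assms is_smooth_conic_qform by metis
  obtain k where "qgrad M (rep_proj_plane P) = k *s l"
    using tangent_line_conic_gradient assms l M by metis
  then show False
    using nondegenerate_no_line[OF M(2) rep_proj_plane_nonzero ne] assms l M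
    by (simp add: on_curve_lform on_curve_qform dot_scale_left)
qed

text \<open>On the line the linear terms of the conic cancel, since its gradient is a multiple of
  the line. The coefficient of order two is the value of the form in the direction \<open>w\<close>
  of the line, and this is nonzero because the conic contains no line. The second claim keeps the
  two branches apart.\<close>

lemma tangent_line_intersection_number:
  assumes "is_line L" "is_smooth_conic Q" "on_curve L P" "on_curve Q P" "tangent_at L Q P"
  shows "intersection_number (multiples (local_eq L P)) (multiples (local_eq Q P)) = 2"
    "\<not> local_eq L P dvd local_eq Q P"
proof -
  let ?v = "rep_proj_plane P"
  let ?d = "chart1 ?v" and ?e = "chart2 ?v"
  obtain l where l: "l \<noteq> 0" "L = lform l" using assms is_line_lform by metis
  obtain M where M: "Q = qform M" "nondegenerate M" using assms is_smooth_conic_qform by metis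
  obtain k where k: "qgrad M ?v = k *s l"
    using tangent_line_conic_gradient assms l M by metis
  have "is_component L" using assms by (simp add: is_component_def)
  from component_local_eq[OF this assms(3)] obtain \<rho> where \<rho>: "germ_param (local_eq L P) \<rho>"
    using germ_param_exists by blast
  then have hom: "comm_ring_hom \<rho>" and const [simp]: "\<rho> (const_fps2 c) = fps_const c"
    and ker: "\<rho> g = 0 \<longleftrightarrow> local_eq L P dvd g" and ct: "fps_nth (\<rho> g) 0 = const_term g" for c g
    by (auto simp: germ_param_def)
  note [simp] = comm_ring_homD[OF hom]
  obtain a b where ab: "(a, b) \<noteq> (0, 0)" "a * dot l ?d + b * dot l ?e = 0"
      "\<And>g. fps_nth (\<rho> g) 1 = a * fst (linear_part g) + b * snd (linear_part g)"
    using \<rho> unfolding germ_param_def l(2) local_eq_lform_parts by auto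
  define S T where "S = \<rho> (fps_const fps_X)" and "T = \<rho> fps_X"
  have S: "fps_nth S 0 = 0" "fps_nth S 1 = a" and T: "fps_nth T 0 = 0" "fps_nth T 1 = b"
    using ab(3) ct by (simp_all add: S_def T_def linear_part_vars)
  have "dot l ?v = 0" using assms l by (simp add: on_curve_lform)
  then have "fps_const (dot l ?d) * S + fps_const (dot l ?e) * T = 0"
    using ker[of "local_eq L P"] by (simp add: l local_eq_lform S_def T_def)
  then have lin: "fps_const k * (fps_const (dot l ?d) * S + fps_const (dot l ?e) * T) = 0" by simp
  have "qval M ?v = 0" using assms M by (simp add: on_curve_qform)
  then have "\<rho> (local_eq Q P) =
      fps_const k * (fps_const (dot l ?d) * S + fps_const (dot l ?e) * T)
      + fps_const (qval M ?d) * (S * S) + fps_const (bil M ?d ?e) * (S * T)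
      + fps_const (qval M ?e) * (T * T)"
    by (simp add: M local_eq_qform S_def T_def k dot_scale_left algebra_simps del: fps_const_mult
        flip: fps_const_mult)
  then have \<rho>Q: "\<rho> (local_eq Q P) = fps_const (qval M ?d) * (S * S)
      + fps_const (bil M ?d ?e) * (S * T) + fps_const (qval M ?e) * (T * T)"
    unfolding lin by simp
  define w where "w = a *s ?d + b *s ?e"
  have "fps_nth (\<rho> (local_eq Q P)) 0 = 0" "fps_nth (\<rho> (local_eq Q P)) 1 = 0"
    using S T by (simp_all add: \<rho>Q fps_mult_nth)
  moreover have "fps_nth (\<rho> (local_eq Q P)) 2 = qval M w"
    using S T by (simp add: \<rho>Q fps_mult_nth numeral_2_eq_2 w_def form_simps algebra_simps)
  moreover have "qval M w \<noteq> 0"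
  proof
    assume "qval M w = 0"
    moreover have "bil M ?v w = k * (a * dot l ?d + b * dot l ?e)"
      by (simp add: k w_def form_simps algebra_simps)
    then have "bil M ?v w = 0" using ab(2) by simp
    moreover have "w \<noteq> c *s ?v" for c
    proof
      assume "w = c *s ?v"
      then have "(- c) *s ?v + (a *s ?d + b *s ?e) = 0"
        unfolding w_def[symmetric] by (simp add: vec_eq_iff)
      then have "(- c) *s ?v + a *s ?d + b *s ?e = 0" by (simp only: add.assoc)
      from chart_independent[OF rep_proj_plane_nonzero this] ab(1) show False by simp
    qed
    ultimately show False
      using nondegenerate_no_line[OF M(2) rep_proj_plane_nonzero] \<open>qval M ?v = 0\<close> by blast
  qed
  ultimately show "intersection_number (multiples (local_eq L P)) (multiples (local_eq Q P)) = 2"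
    "\<not> local_eq L P dvd local_eq Q P"
    using intersection_number_eq_2[OF \<rho>, of "local_eq Q P"] ker[of "local_eq Q P"] by auto
qed

text \<open>Coordinates in which the conic is \<open>y\<^sup>2 = x * z\<close> and the given point
  is the last basis vector. That point becomes the value at infinity of the parametrization by
  \<open>1, \<sigma>, \<sigma>\<^sup>2\<close>.\<close>

lemma conic_normal_form:
  assumes M: "nondegenerate M" and p: "p \<noteq> 0" "qval M p = 0"
  obtains u0 u1 u2 k l where "l \<noteq> 0" "k \<noteq> 0" "u2 = k *s p"
    "\<And>x y z. qval M (x *s u0 + y *s u1 + z *s u2) = l * (y\<^sup>2 - x * z)"
    "\<And>v. \<exists>x y z. v = x *s u0 + y *s u1 + z *s u2"
    "\<And>x y z. x *s u0 + y *s u1 + z *s u2 = 0 \<Longrightarrow> x = 0 \<and> y = 0 \<and> z = 0"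
proof -
  have gp: "qgrad M p \<noteq> 0" using M p by (auto simp: nondegenerate_def)
  then obtain e where e: "bil M p e \<noteq> 0" using covector_nonzero by blast
  define e' where "e' = (1 / bil M p e) *s e"
  have e': "bil M p e' = 1" using e by (simp add: e'_def dot_scale_right)
  \<comment> \<open>The second intersection of the conic with the line through \<open>p\<close> and
    \<open>e'\<close>.\<close>
  define u0 where "u0 = e' + (- qval M e') *s p"
  have pp: "bil M p p = 0" using p by (simp add: bil_self)
  have u0: "qval M u0 = 0" "bil M p u0 = 1" "bil M u0 p = 1"
    unfolding bil_commute[of M u0 p] unfolding u0_def
    using e' p pp bil_commute[of M e' p]
    by (simp_all only: qval_add qval_scale dot_add_right dot_scale_right) simp_all
  \<comment> \<open>The pole of the chord: the common point of the tangent lines at \<open>p\<close>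
    and \<open>u0\<close>.\<close>
  define u1 where "u1 = vcross (qgrad M p) (qgrad M u0)"
  have cross: "u1 \<noteq> 0"
  proof
    assume "u1 = 0"
    then obtain c where c: "qgrad M u0 = c *s qgrad M p"
      using vcross_eq_0D gp unfolding u1_def by blast
    have "bil M u0 u0 = 0" using u0 by (simp add: bil_self)
    then have "c = 0" using u0 by (simp add: c dot_scale_left)
    then show False using u0(3) c by simp
  qed
  have u1: "bil M p u1 = 0" "bil M u0 u1 = 0" "bil M u1 p = 0" "bil M u1 u0 = 0"
    unfolding bil_commute[of M u1] unfolding u1_def by (simp_all add: dot_vcross)
  have span: "\<exists>x y z. v = x *s u0 + y *s u1 + z *s p" for v
  proof -
    \<comment> \<open>The pairings with \<open>p\<close> and \<open>u0\<close> read off the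
      components along \<open>u0\<close> and \<open>p\<close>; removing these leaves a multiple of
      \<open>u1\<close>.\<close>
    define v' where "v' = v + ((- bil M u0 v) *s p + (- bil M p v) *s u0)"
    have uu: "bil M u0 u0 = 0" using u0 by (simp add: bil_self)
    have "bil M p v' = 0" "bil M u0 v' = 0"
      unfolding v'_def dot_add_right dot_scale_right using u0 pp uu by simp_all
    then obtain c where "v' = c *s u1" using vcross_span cross unfolding u1_def by blast
    then have "v = bil M p v *s u0 + c *s u1 + bil M u0 v *s p"
      unfolding v'_def by (simp add: vec_eq_iff algebra_simps)
    then show ?thesis by blast
  qed
  define l where "l = qval M u1"
  have "l \<noteq> 0"
  proof
    assume "l = 0"
    then have "bil M u1 u1 = 0" by (simp add: bil_self l_def)
    then have "bil M u1 v = 0" for v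
      using span[of v] u1 by (auto simp: dot_add_right dot_scale_right)
    then have "qgrad M u1 = 0" using covector_nonzero by blast
    then show False using M cross \<open>l = 0\<close> by (auto simp: nondegenerate_def l_def)
  qed
  \<comment> \<open>In the basis \<open>u0\<close>, \<open>u1\<close>, \<open>p\<close> the form is
    \<open>l * y\<^sup>2 + x * z\<close>; scaling \<open>p\<close> by \<open>- l\<close> makes
    \<open>l\<close> a common factor.\<close>
  define u2 where "u2 = (- l) *s p"
  have "qval M (x *s u0 + y *s u1 + z *s u2) = l * (y\<^sup>2 - x * z)" for x y z
    unfolding u2_def qval_add qval_scale dot_add_right dot_scale_right dot_add_left dot_scale_left
      qgrad_add qgrad_scale
    using u0 u1 p by (simp add: l_def algebra_simps)
  moreover have "\<exists>x y z. v = x *s u0 + y *s u1 + z *s u2" for v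
  proof -
    obtain x y z where "v = x *s u0 + y *s u1 + z *s p" using span by blast
    then have "v = x *s u0 + y *s u1 + (- z / l) *s u2"
      using \<open>l \<noteq> 0\<close> by (simp add: u2_def vec_eq_iff)
    then show ?thesis by blast
  qed
  moreover have "x = 0 \<and> y = 0 \<and> z = 0" if *: "x *s u0 + y *s u1 + z *s u2 = 0" for x y z
  proof -
    have "bil M g (x *s u0 + y *s u1 + z *s u2) = 0" for g using * by simp
    then have b: "x * bil M g u0 + y * bil M g u1 + z * (- l * bil M g p) = 0" for g
      by (simp only: u2_def dot_add_right dot_scale_right)
    have "x = 0" using b[of p] u0 u1 pp by simp
    moreover have "z = 0" using b[of u0] u0 u1 \<open>l \<noteq> 0\<close> bil_self[of M u0] by simp
    ultimately show ?thesis using * cross by (simp add: vec_eq_iff) (metis zero_index)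
  qed
  ultimately show thesis
    using that[of l "- l" u2 u0 u1] \<open>l \<noteq> 0\<close> u2_def by simp
qed

lemma card_roots_simple:
  fixes r :: "complex poly"
  assumes "r \<noteq> 0" "\<And>x. poly r x = 0 \<Longrightarrow> poly (pderiv r) x \<noteq> 0"
  shows "card {x. poly r x = 0} = degree r"
proof -
  have "rsquarefree r" using assms by (auto simp: rsquarefree_roots)
  then have "r = smult (lead_coeff r) (\<Prod>z|poly r z = 0. [:-z, 1:])"
    by (simp add: complex_poly_decompose_rsquarefree)
  then have "degree r = degree (\<Prod>z|poly r z = 0. [:-z, 1:])"
    using assms(1) by (metis degree_smult_eq leading_coeff_0_iff)
  also have "\<dots> = (\<Sum>z|poly r z = 0. degree [:-z, 1:])"
    by (rule degree_prod_eq_sum_degree) auto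
  finally show ?thesis by simp
qed

lemma card_conic_inter_conic:
  assumes Q: "is_smooth_conic Q" and Q': "is_smooth_conic Q'"
    and T: "on_curve Q T" "\<not> on_curve Q' T"
    and transversal: "\<And>P. on_curve Q P \<Longrightarrow> on_curve Q' P \<Longrightarrow> \<not> tangent_at Q Q' P"
  shows "card {P. on_curve Q P \<and> on_curve Q' P} = 4"
proof -
  obtain M where M: "Q = qform M" "nondegenerate M" using Q is_smooth_conic_qform by metis
  obtain N where N: "Q' = qform N" using Q' is_smooth_conic_qform by metis
  define p where "p = rep_proj_plane T"
  have p: "p \<noteq> 0" "qval M p = 0" "qval N p \<noteq> 0"
    using T M N rep_proj_plane_nonzero by (simp_all add: p_def on_curve_qform)
  obtain u0 u1 u2 k l where lk: "l \<noteq> 0" "k \<noteq> 0" and u2: "u2 = k *s p"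
    and normal: "\<And>x y z. qval M (x *s u0 + y *s u1 + z *s u2) = l * (y\<^sup>2 - x * z)"
    and span: "\<And>v. \<exists>x y z. v = x *s u0 + y *s u1 + z *s u2"
    and indep: "\<And>x y z. x *s u0 + y *s u1 + z *s u2 = 0 \<Longrightarrow> x = 0 \<and> y = 0 \<and> z = 0"
    using conic_normal_form[OF M(2) p(1,2)] by metis
  \<comment> \<open>Reaches every point of \<open>Q\<close> except \<open>T\<close>, where the
    coordinate \<open>x\<close> vanishes.\<close>
  define \<phi> where "\<phi> \<sigma> = 1 *s u0 + \<sigma> *s u1 + \<sigma>\<^sup>2 *s u2" for \<sigma>
  have \<phi>_ne: "\<phi> \<sigma> \<noteq> 0" for \<sigma> using indep[of 1 \<sigma> "\<sigma>\<^sup>2"] by (auto simp: \<phi>_def)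
  have \<phi>_M: "qval M (\<phi> \<sigma>) = 0" for \<sigma> unfolding \<phi>_def normal by simp
  define r where "r = [:qval N u0, bil N u0 u1, qval N u1 + bil N u0 u2, bil N u1 u2, qval N u2:]"
  have r: "poly r \<sigma> = qval N (\<phi> \<sigma>)" for \<sigma>
    unfolding r_def \<phi>_def qval_add qval_scale dot_add_right dot_scale_right dot_add_left
      dot_scale_left qgrad_add qgrad_scale
    by (simp add: algebra_simps power2_eq_square)
  have r': "poly (pderiv r) \<sigma> = bil N (\<phi> \<sigma>) (u1 + (2 * \<sigma>) *s u2)" for \<sigma>
    unfolding r_def \<phi>_def dot_add_right dot_scale_right dot_add_left
      dot_scale_left qgrad_add qgrad_scale bil_self bil_commute[of N u1 u0] bil_commute[of N u2]
    by (simp add: pderiv_pCons bil_self bil_commute[of N u2 u1] algebra_simps power2_eq_square)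
  \<comment> \<open>The leading coefficient of \<open>r\<close> is nonzero precisely because
    \<open>T\<close> is not on \<open>Q'\<close>.\<close>
  have u2N: "qval N u2 \<noteq> 0" using p lk by (simp add: u2 qval_scale)
  then have deg: "degree r = 4" "r \<noteq> 0" by (simp_all add: r_def)
  have "\<exists>P c. c \<noteq> 0 \<and> rep_proj_plane P = c *s \<phi> \<sigma>" for \<sigma>
    using proj_plane_exists[OF \<phi>_ne[of \<sigma>]] by metis
  then obtain pt c where pt: "\<And>\<sigma>. c \<sigma> \<noteq> 0" "\<And>\<sigma>. rep_proj_plane (pt \<sigma>) = c \<sigma> *s \<phi> \<sigma>"
    by metis
  have pt_on: "on_curve Q (pt \<sigma>)" "on_curve Q' (pt \<sigma>) \<longleftrightarrow> poly r \<sigma> = 0" for \<sigma>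
    using pt by (simp_all add: M N on_curve_qform qval_scale \<phi>_M r)
  have "poly (pderiv r) \<sigma> \<noteq> 0" if root: "poly r \<sigma> = 0" for \<sigma>
  proof
    assume *: "poly (pderiv r) \<sigma> = 0"
    \<comment> \<open>The derivative of \<open>\<phi>\<close> at \<open>\<sigma>\<close>. It is
      tangent to \<open>Q\<close>, and at a multiple root of \<open>r\<close> also to
      \<open>Q'\<close>.\<close>
    define w where "w = u1 + (2 * \<sigma>) *s u2"
    have "\<phi> \<sigma> + w = 1 *s u0 + (\<sigma> + 1) *s u1 + (\<sigma>\<^sup>2 + 2 * \<sigma>) *s u2"
      by (simp add: \<phi>_def w_def vec_eq_iff algebra_simps)
    then have "qval M (\<phi> \<sigma> + w) = l"
      by (simp only: normal) (simp add: power2_eq_square algebra_simps)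
    moreover have "w = 0 *s u0 + 1 *s u1 + (2 * \<sigma>) *s u2" by (simp add: w_def)
    then have "qval M w = l" by (simp only: normal) simp
    ultimately have "bil M (\<phi> \<sigma>) w = 0" by (simp add: qval_add \<phi>_M)
    then have M0: "bil M (rep_proj_plane (pt \<sigma>)) w = 0"
      by (simp only: pt qgrad_scale dot_scale_left) simp
    have N0: "bil N (rep_proj_plane (pt \<sigma>)) w = 0"
      using * by (simp only: pt qgrad_scale dot_scale_left r' w_def) simp
    have "w \<noteq> d *s rep_proj_plane (pt \<sigma>)" for d
    proof
      assume "w = d *s rep_proj_plane (pt \<sigma>)"
      then have "(d * c \<sigma>) *s u0 + (d * c \<sigma> * \<sigma> - 1) *s u1 + (d * c \<sigma> * \<sigma>\<^sup>2 - 2 * \<sigma>) *s u2 = 0"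
        by (simp add: pt \<phi>_def w_def vec_eq_iff algebra_simps)
      from indep[OF this] show False using pt(1) by auto
    qed
    then have "tangent_at Q Q' (pt \<sigma>)"
      using covectors_common_zero[OF rep_proj_plane_nonzero _ _ M0 N0] pt_on root
      by (simp add: M N tangent_at_def local_eq_qform_parts bil_self on_curve_qform)
    then show False using transversal pt_on root by blast
  qed
  then have "card {\<sigma>. poly r \<sigma> = 0} = 4" using card_roots_simple deg by metis
  moreover have "bij_betw pt {\<sigma>. poly r \<sigma> = 0} {P. on_curve Q P \<and> on_curve Q' P}"
  proof (rule bij_betwI')
    fix \<sigma> \<tau>
    show "pt \<sigma> = pt \<tau> \<longleftrightarrow> \<sigma> = \<tau>"
    proof
      assume "pt \<sigma> = pt \<tau>"
      then have "c \<sigma> *s \<phi> \<sigma> = c \<tau> *s \<phi> \<tau>" using pt(2) by metis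
      then have "(c \<sigma> - c \<tau>) *s u0 + (c \<sigma> * \<sigma> - c \<tau> * \<tau>) *s u1
          + (c \<sigma> * \<sigma>\<^sup>2 - c \<tau> * \<tau>\<^sup>2) *s u2 = 0"
        by (simp add: \<phi>_def vec_eq_iff algebra_simps)
      from indep[OF this] show "\<sigma> = \<tau>" using pt(1) by auto
    qed simp
  next
    fix P assume P: "P \<in> {P. on_curve Q P \<and> on_curve Q' P}"
    obtain x y z where xyz: "rep_proj_plane P = x *s u0 + y *s u1 + z *s u2" using span by blast
    have eq: "y\<^sup>2 = x * z" using P lk by (simp add: M on_curve_qform xyz normal)
    have "x \<noteq> 0"
    proof
      assume "x = 0"
      then have "rep_proj_plane P = z *s u2" using eq by (simp add: xyz)
      then have "z = 0" using P u2N by (simp add: N on_curve_qform qval_scale)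
      then show False using \<open>rep_proj_plane P = z *s u2\<close> rep_proj_plane_nonzero by simp
    qed
    then have "z = x * (y / x)\<^sup>2" using eq by (simp add: power2_eq_square field_simps)
    then have "rep_proj_plane P = x *s \<phi> (y / x)"
      using \<open>x \<noteq> 0\<close> by (simp add: xyz \<phi>_def vec_eq_iff algebra_simps)
    also have "\<dots> = (x / c (y / x)) *s rep_proj_plane (pt (y / x))"
      using pt(1) by (simp add: pt(2) vec_eq_iff)
    finally have "P = pt (y / x)" by (rule proj_plane_eqI)
    then show "\<exists>\<sigma>\<in>{\<sigma>. poly r \<sigma> = 0}. P = pt \<sigma>" using P pt_on by auto
  qed (use pt_on in auto)
  ultimately show ?thesis by (metis bij_betw_same_card)
qed

section \<open>Reduced unions of lines and conics\<close>

lemma comm_ring_hom_unit: "comm_ring_hom h \<Longrightarrow> u dvd 1 \<Longrightarrow> h u dvd 1"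
  by (metis comm_ring_homD(2) comm_ring_hom_dvd)

definition value_at :: "proj_plane \<Rightarrow> poly3 \<Rightarrow> complex" where
  "value_at P F = (let v = rep_proj_plane P in eval3 (\<lambda>c. c) F (v $ 1) (v $ 2) (v $ 3))"

lemma on_curve_iff: "on_curve F P \<longleftrightarrow> value_at P F = 0"
  by (simp add: on_curve_def value_at_def Let_def)

lemma comm_ring_hom_value_at: "comm_ring_hom (value_at P)"
  unfolding value_at_def Let_def by (intro comm_ring_hom_eval3 comm_ring_hom_id)

lemma value_at_const3: "value_at P (const3 c) = c"
  by (simp add: value_at_def Let_def eval3_const3 comm_ring_hom_id)

definition comps_at :: "poly3 set \<Rightarrow> proj_plane \<Rightarrow> poly3 set" where
  "comps_at S P = {D \<in> S. on_curve D P}"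

text \<open>The set of components is a parameter, so that the same lemmas serve a single component,
  a fiber and the whole arrangement.\<close>

definition reduced_curve :: "poly3 \<Rightarrow> poly3 set \<Rightarrow> bool" where
  "reduced_curve M S \<longleftrightarrow> finite S \<and> (\<forall>D\<in>S. is_component D) \<and> (\<exists>u. u dvd 1 \<and> M = u * (\<Prod>D\<in>S. D))"

lemma reduced_curve_singleton: "is_component D \<Longrightarrow> reduced_curve D {D}"
  unfolding reduced_curve_def by (auto intro!: exI[of _ 1])

lemma reduced_curve_on_curve:
  assumes "reduced_curve M S"
  shows "on_curve M P \<longleftrightarrow> comps_at S P \<noteq> {}"
proof -
  obtain u where u: "u dvd 1" "M = u * (\<Prod>D\<in>S. D)" and "finite S"
    using assms by (auto simp: reduced_curve_def)
  have "value_at P u \<noteq> 0" using comm_ring_hom_unit[OF comm_ring_hom_value_at u(1)]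
    by (auto simp: dvd_field_iff)
  then show ?thesis
    using \<open>finite S\<close>
    by (auto simp: on_curve_iff u(2) comm_ring_homD[OF comm_ring_hom_value_at]
        comm_ring_hom_prod[OF comm_ring_hom_value_at] comps_at_def)
qed

text \<open>Components that miss \<open>P\<close> have local equations with nonzero constant term;
  these are units and are absorbed into \<open>U\<close>.\<close>

lemma reduced_curve_local_eq:
  assumes "reduced_curve M S"
  obtains U where "U dvd 1" "local_eq M P = U * (\<Prod>D\<in>comps_at S P. local_eq D P)"
proof -
  note hom = comm_ring_hom_local_eq[of P]
  obtain u where u: "u dvd 1" "M = u * (\<Prod>D\<in>S. D)" and S: "finite S" "\<forall>D\<in>S. is_component D"
    using assms by (auto simp: reduced_curve_def)
  let ?rest = "\<Prod>D\<in>S - comps_at S P. local_eq D P"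
  have "const_term ?rest \<noteq> 0"
    using S component_local_eq_unit
    by (auto simp: comm_ring_hom_prod[OF comm_ring_hom_const_term] comps_at_def)
  moreover have "const_term (local_eq u P) \<noteq> 0"
    using comm_ring_hom_unit[OF hom u(1)] by (simp add: is_unit_fps2_iff)
  ultimately have "local_eq u P * ?rest dvd 1"
    by (simp add: is_unit_fps2_iff const_term_mult)
  moreover have "(\<Prod>D\<in>S. local_eq D P) = ?rest * (\<Prod>D\<in>comps_at S P. local_eq D P)"
    using S(1) by (intro prod.subset_diff) (auto simp: comps_at_def)
  then have "local_eq M P = local_eq u P * ?rest * (\<Prod>D\<in>comps_at S P. local_eq D P)"
    by (simp add: u(2) comm_ring_homD[OF hom] comm_ring_hom_prod[OF hom] mult.assoc)
  ultimately show thesis by (rule that)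
qed

lemma reduced_curve_comps:
  assumes "reduced_curve M S" "D \<in> comps_at S P"
  shows "is_component D" "on_curve D P" "const_term (local_eq D P) = 0"
    "linear_part (local_eq D P) \<noteq> (0, 0)"
proof -
  show "is_component D" "on_curve D P" using assms by (auto simp: reduced_curve_def comps_at_def)
  then show "const_term (local_eq D P) = 0" "linear_part (local_eq D P) \<noteq> (0, 0)"
    using component_local_eq by blast+
qed

lemma reduced_curve_branches:
  assumes "reduced_curve M S"
  shows "branches M P = (\<lambda>D. multiples (local_eq D P)) ` comps_at S P"
proof -
  obtain U where U: "U dvd 1" "local_eq M P = U * (\<Prod>D\<in>comps_at S P. local_eq D P)"
    using reduced_curve_local_eq[OF assms] by blast
  have "finite (comps_at S P)" using assms by (auto simp: reduced_curve_def comps_at_def)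
  then show ?thesis
    using U reduced_curve_comps[OF assms] by (intro branches_eq[OF _ smooth_prime_elem]) auto
qed

lemma reduced_curve_germ:
  assumes "reduced_curve M S" "comps_at S P = {D}"
  shows "germ M P = multiples (local_eq D P)"
proof -
  obtain U where "U dvd 1" "local_eq M P = U * (\<Prod>D\<in>comps_at S P. local_eq D P)"
    using reduced_curve_local_eq[OF assms(1)] by blast
  then have U: "U dvd 1" "local_eq M P = U * local_eq D P" by (simp_all add: assms(2))
  obtain V where V: "1 = U * V" using U(1) by (rule dvdE)
  have "local_eq M P * V = (U * V) * local_eq D P" by (simp only: U(2) mult_ac)
  also have "\<dots> = local_eq D P" by (simp only: V[symmetric] mult_1)
  finally have "local_eq M P dvd local_eq D P" by (rule dvdI[OF sym])
  then show ?thesis using U(2) by (simp add: germ_def multiples_eq_iff)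
qed

text \<open>With two distinct components through \<open>P\<close>, the local equation is a product
  with two non-unit factors and has no linear part; with one component it is a smooth equation up to
  a unit.\<close>

lemma reduced_curve_Sing:
  assumes "reduced_curve M S"
  shows "P \<in> Sing M \<longleftrightarrow> (\<exists>D\<in>comps_at S P. \<exists>E\<in>comps_at S P. D \<noteq> E)"
proof
  assume P: "P \<in> Sing M"
  show "\<exists>D\<in>comps_at S P. \<exists>E\<in>comps_at S P. D \<noteq> E"
  proof (rule ccontr)
    assume *: "\<not> (\<exists>D\<in>comps_at S P. \<exists>E\<in>comps_at S P. D \<noteq> E)"
    have "comps_at S P \<noteq> {}" using P reduced_curve_on_curve[OF assms] by (auto simp: Sing_def)
    then obtain D where D: "D \<in> comps_at S P" by blast
    then have "comps_at S P = {D}" using * by blast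
    then have "smooth_germ (germ M P)"
      using reduced_curve_comps[OF assms D]
      by (simp add: reduced_curve_germ[OF assms] smooth_germ_multiples)
    then show False using P by (simp add: Sing_def)
  qed
next
  assume "\<exists>D\<in>comps_at S P. \<exists>E\<in>comps_at S P. D \<noteq> E"
  then obtain D E where DE: "D \<in> comps_at S P" "E \<in> comps_at S P" "D \<noteq> E" by blast
  obtain U where U: "local_eq M P = U * (\<Prod>D\<in>comps_at S P. local_eq D P)"
    using reduced_curve_local_eq[OF assms] by blast
  have fin: "finite (comps_at S P)" using assms by (auto simp: reduced_curve_def comps_at_def)
  have "(\<Prod>D\<in>comps_at S P. local_eq D P) =
      local_eq D P * (local_eq E P * (\<Prod>D\<in>comps_at S P - {D} - {E}. local_eq D P))"
    using DE fin prod.remove[of "comps_at S P" D "\<lambda>D. local_eq D P"]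
      prod.remove[of "comps_at S P - {D}" E "\<lambda>D. local_eq D P"] by simp
  then have "local_eq M P = local_eq D P *
      (local_eq E P * (U * (\<Prod>D\<in>comps_at S P - {D} - {E}. local_eq D P)))"
    by (simp only: U mult.left_commute)
  then have "const_term (local_eq M P) = 0" "linear_part (local_eq M P) = (0, 0)"
    using reduced_curve_comps[OF assms DE(1)] reduced_curve_comps[OF assms DE(2)]
    by (simp_all add: const_term_mult linear_part_mult)
  moreover have "on_curve M P" using reduced_curve_on_curve[OF assms] DE by blast
  ultimately show "P \<in> Sing M" by (simp add: Sing_def germ_def smooth_germ_multiples)
qed

lemma comps_tangent_eq_iff:
  assumes "reduced_curve M S" "D \<in> comps_at S P" "E \<in> comps_at S P"
  shows "tangent (multiples (local_eq D P)) = tangent (multiples (local_eq E P)) \<longleftrightarrow> tangent_at D E P"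
  using reduced_curve_comps[OF assms(1)] assms(2,3)
  by (subst tangent_multiples_eq_iff) (auto simp: tangent_at_def)

lemma reduced_curve_not_ordinary:
  assumes "reduced_curve M S" "\<not> ordinary_at M P"
  obtains D E where "D \<in> comps_at S P" "E \<in> comps_at S P" "D \<noteq> E" "tangent_at D E P"
proof -
  have "smooth_germ (multiples (local_eq D P))" if "D \<in> comps_at S P" for D
    using reduced_curve_comps[OF assms(1) that] by (simp add: smooth_germ_multiples)
  then obtain D E where "D \<in> comps_at S P" "E \<in> comps_at S P"
      "multiples (local_eq D P) \<noteq> multiples (local_eq E P)"
      "tangent (multiples (local_eq D P)) = tangent (multiples (local_eq E P))"
    using assms(2) unfolding ordinary_at_def reduced_curve_branches[OF assms(1)] by blast
  then show thesis using that comps_tangent_eq_iff[OF assms(1)] by metis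
qed

section \<open>Degrees\<close>

lemma homogeneous_mult:
  assumes "homogeneous d F" "homogeneous e G"
  shows "homogeneous (d + e) (F * G)"
  unfolding homogeneous_def
proof (intro allI impI)
  fix i j k
  assume "coeff (coeff (coeff (F * G) k) j) i \<noteq> 0"
  then have "(\<Sum>c\<le>k. \<Sum>b\<le>j. \<Sum>a\<le>i. coeff (coeff (coeff F c) b) a *
      coeff (coeff (coeff G (k - c)) (j - b)) (i - a)) \<noteq> 0"
    by (simp add: coeff_mult coeff_sum)
  then obtain c b a where le: "c \<le> k" "b \<le> j" "a \<le> i"
    and "coeff (coeff (coeff F c) b) a * coeff (coeff (coeff G (k - c)) (j - b)) (i - a) \<noteq> 0"
    by (meson atMost_iff sum.not_neutral_contains_not_neutral)
  then have "coeff (coeff (coeff F c) b) a \<noteq> 0"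
      "coeff (coeff (coeff G (k - c)) (j - b)) (i - a) \<noteq> 0"
    by auto
  then have "a + b + c = d" "i - a + (j - b) + (k - c) = e"
    using assms unfolding homogeneous_def by blast+
  then show "i + j + k = d + e" using le by linarith
qed

lemma homogeneous_const3: "homogeneous 0 (const3 c)"
  by (auto simp: homogeneous_def const3_def coeff_pCons split: nat.splits)

lemma homogeneous_add: "homogeneous d F \<Longrightarrow> homogeneous d G \<Longrightarrow> homogeneous d (F + G)"
  unfolding homogeneous_def by (metis add.right_neutral coeff_add)

lemma homogeneous_prod:
  assumes "\<And>D. D \<in> S \<Longrightarrow> homogeneous (d D) D"
  shows "homogeneous (\<Sum>D\<in>S. d D) (\<Prod>D\<in>S. D)"
  using assms
proof (induction S rule: infinite_finite_induct)
  case (insert D S)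
  then show ?case by (simp add: homogeneous_mult)
qed (use homogeneous_const3[of 1] in \<open>simp_all add: const3_def pCons_one\<close>)

lemma homogeneous_unique:
  assumes "homogeneous d F" "homogeneous e F" "F \<noteq> 0"
  shows "d = e"
proof -
  obtain i j k where "coeff (coeff (coeff F k) j) i \<noteq> 0"
    using assms(3) leading_coeff_neq_0 by metis
  then show ?thesis using assms unfolding homogeneous_def by metis
qed

lemma poly3_unit_const3:
  fixes u :: poly3
  assumes "u dvd 1"
  obtains c where "u = const3 c"
  using assms that by (auto simp: is_unit_poly_iff const3_def)

lemma line_not_conic: "is_line D \<Longrightarrow> \<not> is_smooth_conic D"
  using homogeneous_unique by (fastforce simp: is_line_def is_smooth_conic_def)

lemma Irr_normalize: "D \<in> Irr M \<Longrightarrow> normalize D = D"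
  by (auto simp: Irr_def intro: normalize_prime)

text \<open>Squarefreeness gives every prime factor multiplicity one, so the multiset of prime
  factors is the set \<open>Irr M\<close>.\<close>

lemma squarefree_reduced_curve:
  assumes "M \<noteq> 0" "squarefree M" "\<And>D. D \<in> Irr M \<Longrightarrow> is_component D"
  shows "reduced_curve M (Irr M)"
proof -
  have "count (prime_factorization M) D = count (mset_set (prime_factors M)) D" for D
  proof (cases "D \<in> prime_factors M")
    case True
    then have "multiplicity D M = 1"
      using assms squarefree_factorial_semiring' by blast
    then show ?thesis
      using True by (simp add: count_prime_factorization_prime in_prime_factors_imp_prime)
  next
    case False
    then show ?thesis by (metis count_mset_set(3) not_in_iff)
  qed
  then have "prime_factorization M = mset_set (prime_factors M)" by (rule multiset_eqI)
  then have "prod_mset (prime_factorization M) = (\<Prod>D\<in>Irr M. D)"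
    by (simp add: Irr_def prod_unfold_prod_mset)
  then have "normalize M = normalize (\<Prod>D\<in>Irr M. D)"
    using prod_mset_prime_factorization_weak[OF assms(1)] by simp
  then obtain u where "u dvd 1" "M = u * (\<Prod>D\<in>Irr M. D)" by (rule associatedE1)
  then show ?thesis using assms(3) by (auto simp: reduced_curve_def Irr_def)
qed

text \<open>The degrees of the components add up to three; the conic uses two, which leaves a single
  component of degree one.\<close>

lemma cubic_with_conic:
  assumes M: "homogeneous 3 M" "M \<noteq> 0" and red: "reduced_curve M S" and Q: "Q \<in> S" "is_smooth_conic Q"
  obtains L where "S = {L, Q}" "is_line L"
proof -
  define d where "d D = (if is_line D then 1 else 2 :: nat)" for D
  obtain u where u: "u dvd 1" "M = u * (\<Prod>D\<in>S. D)" and S: "finite S" "\<forall>D\<in>S. is_component D"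
    using red by (auto simp: reduced_curve_def)
  obtain c where c: "u = const3 c" using poly3_unit_const3 u(1) by blast
  have "homogeneous (d D) D" if "D \<in> S" for D
    using S that by (auto simp: d_def is_component_def is_line_def is_smooth_conic_def)
  then have "homogeneous (0 + (\<Sum>D\<in>S. d D)) M"
    unfolding u(2) c by (intro homogeneous_mult homogeneous_const3 homogeneous_prod)
  then have "(\<Sum>D\<in>S. d D) = 3" using homogeneous_unique M by fastforce
  moreover have "d Q = 2" using Q line_not_conic by (auto simp: d_def)
  ultimately have "(\<Sum>D\<in>S - {Q}. d D) = 1"
    using sum.remove[OF S(1) Q(1), of d] by simp
  then have "\<exists>L\<in>S - {Q}. d L = 1 \<and> (\<forall>D\<in>S - {Q}. L \<noteq> D \<longrightarrow> d D = 0)"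
    by (simp only: sum_eq_1_iff[OF finite_Diff[OF S(1)]])
  then obtain L where L: "L \<in> S - {Q}" "d L = 1" "\<forall>D\<in>S - {Q}. L \<noteq> D \<longrightarrow> d D = 0"
    by blast
  have "d D \<noteq> 0" for D by (simp add: d_def)
  then have "\<forall>D\<in>S - {Q}. L = D" using L(3) by metis
  then have "D = L \<or> D = Q" if "D \<in> S" for D using that by (metis DiffI singletonD)
  then have "S = {L, Q}"
  proof (intro set_eqI iffI)
    fix D assume "D \<in> {L, Q}"
    then show "D \<in> S" using L(1) Q(1) by (elim insertE) simp_all
  qed simp
  moreover have "is_line L" using L(2) by (auto simp: d_def split: if_splits)
  ultimately show thesis by (rule that)
qed

section \<open>Components of the fibers\<close>

locale pencil_arrangement =
  fixes F G \<C> :: poly3 and C :: "nat \<Rightarrow> poly3"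
  assumes pencil: "conic_line_pencil 3 F G"
    and fibers: "\<And>i. i \<in> {1..4} \<Longrightarrow> conic_line_fiber F G (C i)"
    and distinct_fibers: "inj_on (\<lambda>i. normalize (C i)) {1..4}"
    and arrangement: "\<C> = (\<Prod>i\<in>{1..4}. C i)"
    and transversal: "\<And>P i j. P \<in> base_points F G \<Longrightarrow> i \<in> {1..4} \<Longrightarrow> j \<in> {1..4} \<Longrightarrow> i \<noteq> j \<Longrightarrow>
                        transversal_at (C i) (C j) P"
    and non_ordinary: "card (non_ordinary_points \<C>) = 4"
    and even_lines: "\<And>P. P \<in> base_points F G \<Longrightarrow>
                       even (card {L \<in> Irr \<C>. is_line L \<and> on_curve L P})"
begin

lemma pencil_generators: "homogeneous 3 F" "homogeneous 3 G" "coprime F G"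
  using pencil by (auto simp: conic_line_pencil_def primitive_pencil_def)

lemma fiber_coeffs: "\<exists>a b. \<forall>i\<in>{1..4}. (a i, b i) \<noteq> (0, 0) \<and> C i = const3 (a i) * F + const3 (b i) * G"
proof -
  have "\<forall>i\<in>{1..4}. \<exists>a b. (a, b) \<noteq> (0, 0) \<and> C i = const3 a * F + const3 b * G"
    using fibers unfolding conic_line_fiber_def pencil_members_def by blast
  then show ?thesis by metis
qed

text \<open>Cramer's rule for the coefficients of two members. A zero determinant would make the
  members agree up to a unit. Consequently, common points and common factors of two fibers belong to
  both generators.\<close>

lemma fibers_generate:
  assumes "i \<in> {1..4}" "j \<in> {1..4}" "i \<noteq> j"
  obtains c a b a' b' where "c \<noteq> 0" "const3 c * F = const3 a * C i + const3 b * C j"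
    "const3 c * G = const3 a' * C i + const3 b' * C j"
proof -
  obtain a b where ab: "\<And>i. i \<in> {1..4} \<Longrightarrow> (a i, b i) \<noteq> (0, 0)"
      "\<And>i. i \<in> {1..4} \<Longrightarrow> C i = const3 (a i) * F + const3 (b i) * G"
    using fiber_coeffs by metis
  let ?c = "a i * b j - a j * b i"
  have "?c \<noteq> 0"
  proof
    assume c0: "?c = 0"
    have "\<exists>k. k \<noteq> 0 \<and> a j = k * a i \<and> b j = k * b i"
    proof (cases "a i = 0")
      case True
      then have "b i \<noteq> 0" "a j = 0" using ab(1)[OF assms(1)] c0 by auto
      moreover from this have "b j \<noteq> 0" using ab(1)[OF assms(2)] by auto
      ultimately show ?thesis using True by (intro exI[of _ "b j / b i"]) simp
    next
      case False
      have "a j \<noteq> 0"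
      proof
        assume "a j = 0"
        then have "b j = 0" using c0 False by simp
        then show False using ab(1)[OF assms(2)] \<open>a j = 0\<close> by simp
      qed
      then show ?thesis
        using False c0 by (intro exI[of _ "a j / a i"]) (simp add: field_simps)
    qed
    then obtain k where k: "k \<noteq> 0" "a j = k * a i" "b j = k * b i" by blast
    have "C j = const3 k * C i"
      unfolding ab(2)[OF assms(1)] ab(2)[OF assms(2)] k(2,3) const3_hom by (simp only: ring_distribs mult.assoc)
    then have "normalize (C j) = normalize (C i)"
      using const3_unit[OF k(1)] by (simp add: normalize_mult_unit_left)
    then show False using distinct_fibers assms by (auto simp: inj_on_def)
  qed
  moreover have "const3 ?c * F = const3 (b j) * C i + const3 (- b i) * C j"
    "const3 ?c * G = const3 (- a j) * C i + const3 (a i) * C j"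
    unfolding ab(2)[OF assms(1)] ab(2)[OF assms(2)]
    unfolding const3_hom by (simp_all add: algebra_simps)
  ultimately show thesis by (rule that)
qed

lemma base_point_iff:
  assumes "i \<in> {1..4}" "j \<in> {1..4}" "i \<noteq> j"
  shows "P \<in> base_points F G \<longleftrightarrow> on_curve (C i) P \<and> on_curve (C j) P"
proof
  note hom = comm_ring_homD[OF comm_ring_hom_value_at]
  assume "P \<in> base_points F G"
  then show "on_curve (C i) P \<and> on_curve (C j) P"
    using fiber_coeffs assms by (auto simp: base_points_def on_curve_iff hom)
next
  note hom = comm_ring_homD[OF comm_ring_hom_value_at] value_at_const3
  assume *: "on_curve (C i) P \<and> on_curve (C j) P"
  obtain c a b a' b' where c: "c \<noteq> 0" "const3 c * F = const3 a * C i + const3 b * C j"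
    "const3 c * G = const3 a' * C i + const3 b' * C j"
    using fibers_generate assms by metis
  show "P \<in> base_points F G"
    using arg_cong[OF c(2), of "value_at P"] arg_cong[OF c(3), of "value_at P"] * c(1)
    by (simp add: base_points_def on_curve_iff hom)
qed

lemma fiber_facts:
  assumes "i \<in> {1..4}"
  shows "homogeneous 3 (C i)" "C i \<noteq> 0" "reduced_curve (C i) (Irr (C i))"
proof -
  note f = fibers[OF assms]
  show "homogeneous 3 (C i)"
    using fiber_coeffs assms pencil_generators homogeneous_mult[OF homogeneous_const3]
    by (metis add_0 homogeneous_add)
  show nz: "C i \<noteq> 0" using f by (auto simp: conic_line_fiber_def)
  show "reduced_curve (C i) (Irr (C i))"
    using f nz by (intro squarefree_reduced_curve) (auto simp: conic_line_fiber_def is_component_def)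
qed

text \<open>A common component would divide both \<open>F\<close> and \<open>G\<close>, which are
  coprime.\<close>

lemma Irr_disjoint:
  assumes "i \<in> {1..4}" "j \<in> {1..4}" "i \<noteq> j"
  shows "Irr (C i) \<inter> Irr (C j) = {}"
proof (rule ccontr)
  assume "Irr (C i) \<inter> Irr (C j) \<noteq> {}"
  then obtain D where D: "D dvd C i" "D dvd C j" "prime D"
    by (auto simp: Irr_def in_prime_factors_iff)
  obtain c a b a' b' where c: "c \<noteq> 0" "const3 c * F = const3 a * C i + const3 b * C j"
    "const3 c * G = const3 a' * C i + const3 b' * C j"
    using fibers_generate assms by metis
  have "D dvd const3 c * F" "D dvd const3 c * G"
    unfolding c(2,3) using D by (simp_all add: dvd_add dvd_mult)
  then have "D dvd F" "D dvd G" using const3_unit[OF c(1)] by (simp_all add: dvd_mult_unit_iff')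
  then have "D dvd 1" using pencil_generators(3) coprime_common_divisor by blast
  then show False using D(3) by simp
qed

lemma Irr_arrangement: "Irr \<C> = (\<Union>i\<in>{1..4}. Irr (C i))"
  unfolding Irr_def arrangement
  using fiber_facts by (subst prime_factorization_prod) (auto simp: set_mset_sum)

lemma reduced_arrangement: "reduced_curve \<C> (Irr \<C>)"
proof -
  have "\<forall>i\<in>{1..4}. \<exists>u. u dvd 1 \<and> C i = u * (\<Prod>D\<in>Irr (C i). D)"
    using fiber_facts(3) by (auto simp: reduced_curve_def)
  then obtain u where u: "\<And>i. i \<in> {1..4} \<Longrightarrow> u i dvd 1"
      "\<And>i. i \<in> {1..4} \<Longrightarrow> C i = u i * (\<Prod>D\<in>Irr (C i). D)"
    by metis
  have "\<C> = (\<Prod>i\<in>{1..4}. u i * (\<Prod>D\<in>Irr (C i). D))"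
    unfolding arrangement by (rule prod.cong[OF refl u(2)])
  also have "\<dots> = (\<Prod>i\<in>{1..4}. u i) * (\<Prod>i\<in>{1..4}. \<Prod>D\<in>Irr (C i). D)"
    by (rule prod.distrib)
  also have "(\<Prod>i\<in>{1..4}. \<Prod>D\<in>Irr (C i). D) = (\<Prod>D\<in>Irr \<C>. D)"
    unfolding Irr_arrangement
    using Irr_disjoint by (intro prod.UNION_disjoint[symmetric]) (auto simp: Irr_def)
  finally have "\<C> = (\<Prod>i\<in>{1..4}. u i) * (\<Prod>D\<in>Irr \<C>. D)" .
  moreover have "(\<Prod>i\<in>{1..4}. u i) dvd 1" 
    using prod_dvd_prod[of "{1..4}" u "\<lambda>_. 1"] u(1) by simp
  moreover have "is_component D" if "D \<in> Irr \<C>" for D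
    using that fiber_facts(3) by (auto simp: Irr_arrangement reduced_curve_def)
  moreover have "finite (Irr \<C>)" by (simp add: Irr_def)
  ultimately show ?thesis unfolding reduced_curve_def by blast
qed

lemma fiber_on_curve:
  "i \<in> {1..4} \<Longrightarrow> on_curve (C i) P \<longleftrightarrow> (\<exists>D\<in>Irr (C i). on_curve D P)"
  using reduced_curve_on_curve[OF fiber_facts(3)] by (auto simp: comps_at_def)

lemma base_point_comps:
  assumes "P \<in> base_points F G" "i \<in> {1..4}"
  shows "\<exists>D. comps_at (Irr (C i)) P = {D}"
proof -
  \<comment> \<open>Any second fiber serves: transversality with it includes smoothness of fiber
    \<open>i\<close> at \<open>P\<close>, and a smooth point lies on one component only.\<close>
  define j :: nat where "j = (if i = 1 then 2 else 1)"
  have "transversal_at (C i) (C j) P" using transversal assms by (auto simp: j_def)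
  then have "on_curve (C i) P" "P \<notin> Sing (C i)" by (auto simp: transversal_at_def Sing_def)
  then have "comps_at (Irr (C i)) P \<noteq> {}"
      "\<forall>D\<in>comps_at (Irr (C i)) P. \<forall>E\<in>comps_at (Irr (C i)) P. D = E"
    using reduced_curve_on_curve[OF fiber_facts(3)] reduced_curve_Sing[OF fiber_facts(3)] assms
    by blast+
  then show ?thesis by blast
qed

text \<open>A point on two fibers is a base point. There \<open>D\<close> and \<open>E\<close> are
  the only components of their fibers, so the germs of the fibers are those of \<open>D\<close> and
  \<open>E\<close>, and transversality passes to them.\<close>

lemma different_fibers_transversal:
  assumes ij: "i \<in> {1..4}" "j \<in> {1..4}" "i \<noteq> j"
    and D: "D \<in> Irr (C i)" "on_curve D P" and E: "E \<in> Irr (C j)" "on_curve E P"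
  shows "P \<in> base_points F G" "\<not> tangent_at D E P"
proof -
  show P: "P \<in> base_points F G"
    using base_point_iff fiber_on_curve ij D E by blast
  have single: "comps_at (Irr (C k)) P = {A}" if "k \<in> {1..4}" "A \<in> Irr (C k)" "on_curve A P" for k A
  proof -
    obtain B where "comps_at (Irr (C k)) P = {B}" using base_point_comps[OF P \<open>k \<in> {1..4}\<close>] by blast
    moreover have "A \<in> comps_at (Irr (C k)) P" using that by (simp add: comps_at_def)
    ultimately show ?thesis by simp
  qed
  have *: "comps_at (Irr (C i)) P = {D}" "comps_at (Irr (C j)) P = {E}"
    using single ij D E by blast+
  have "tangent (multiples (local_eq D P)) \<noteq> tangent (multiples (local_eq E P))"
    using transversal[OF P ij] reduced_curve_germ[OF fiber_facts(3)] ij *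
    by (auto simp: transversal_at_def)
  moreover have DE: "D \<in> comps_at (Irr \<C>) P" "E \<in> comps_at (Irr \<C>) P"
    using ij D E unfolding comps_at_def Irr_arrangement by blast+
  ultimately show "\<not> tangent_at D E P"
    using comps_tangent_eq_iff[OF reduced_arrangement DE] by blast
qed

text \<open>The two tangent components lie in the same fiber. They cannot both be lines, as tangent
  lines coincide, and a fiber containing a conic has only a line besides it.\<close>

lemma non_ordinary_tangency:
  assumes "P \<in> non_ordinary_points \<C>"
  shows "\<exists>i\<in>{1..4}. \<exists>L Q. Irr (C i) = {L, Q} \<and> is_line L \<and> is_smooth_conic Q \<and>
    on_curve L P \<and> on_curve Q P \<and> tangent_at L Q P"
proof -
  have "\<not> ordinary_at \<C> P" using assms by (simp add: non_ordinary_points_def)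
  then obtain D E where DE: "D \<in> comps_at (Irr \<C>) P" "E \<in> comps_at (Irr \<C>) P" "D \<noteq> E"
      "tangent_at D E P"
    using reduced_curve_not_ordinary[OF reduced_arrangement] by blast
  then obtain i j where ij: "i \<in> {1..4}" "j \<in> {1..4}" "D \<in> Irr (C i)" "E \<in> Irr (C j)"
      and on: "on_curve D P" "on_curve E P"
    by (auto simp: comps_at_def Irr_arrangement)
  then have "i = j" using different_fibers_transversal(2) DE(4) by blast
  have line_conic: "\<exists>L Q. Irr (C i) = {L, Q} \<and> is_line L \<and> is_smooth_conic Q \<and>
      on_curve L P \<and> on_curve Q P \<and> tangent_at L Q P"
    if Q: "Q \<in> Irr (C i)" "is_smooth_conic Q" and A: "A \<in> Irr (C i)" "A \<noteq> Q" "on_curve Q P" "on_curve A P"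
      "tangent_at A Q P" for A Q
  proof -
    obtain L where L: "Irr (C i) = {L, Q}" "is_line L"
      by (rule cubic_with_conic[OF fiber_facts[OF ij(1)] Q])
    then have "A = L" using A by simp
    then show ?thesis using L Q A by (intro exI[of _ L] exI[of _ Q]) simp
  qed
  have comp: "is_component D" "is_component E"
    using fiber_facts(3)[OF ij(1)] ij \<open>i = j\<close> by (auto simp: reduced_curve_def)
  have "\<not> (is_line D \<and> is_line E)"
    using tangent_lines_eq DE(3,4) on ij Irr_normalize by metis
  then have "is_smooth_conic D \<or> is_smooth_conic E" using comp by (auto simp: is_component_def)
  then show ?thesis
    using line_conic[of D E] line_conic[of E D] ij \<open>i = j\<close> on DE(3,4) tangent_at_commute by blast
qed

lemma all_fibers_tangent:
  "\<exists>L Q T. \<forall>i\<in>{1..4}. Irr (C i) = {L i, Q i} \<and> is_line (L i) \<and> is_smooth_conic (Q i) \<and>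
    on_curve (L i) (T i) \<and> on_curve (Q i) (T i) \<and> tangent_at (L i) (Q i) (T i)"
proof -
  let ?R = "\<lambda>P i. \<exists>L Q. Irr (C i) = {L, Q} \<and> is_line L \<and> is_smooth_conic Q \<and>
    on_curve L P \<and> on_curve Q P \<and> tangent_at L Q P"
  let ?N = "non_ordinary_points \<C>"
  have "\<forall>P\<in>?N. \<exists>i. i \<in> {1..4} \<and> ?R P i" using non_ordinary_tangency by blast
  then obtain f where f: "\<And>P. P \<in> ?N \<Longrightarrow> f P \<in> {1..4}" "\<And>P. P \<in> ?N \<Longrightarrow> ?R P (f P)"
    by metis
  \<comment> \<open>Line and conic of a fiber are told apart by their degrees, so two points with
    the same index concern the same pair, which has only one common point. With four points and four
    indices, \<open>f\<close> is then onto.\<close>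
  have "inj_on f ?N"
  proof (rule inj_onI)
    fix P P' assume P: "P \<in> ?N" "P' \<in> ?N" "f P = f P'"
    obtain L Q where LQ: "Irr (C (f P)) = {L, Q}" "is_line L" "is_smooth_conic Q"
      "on_curve L P" "on_curve Q P" "tangent_at L Q P" using f(2)[OF P(1)] by blast
    obtain L' Q' where LQ': "Irr (C (f P)) = {L', Q'}" "is_line L'" "is_smooth_conic Q'"
      "on_curve L' P'" "on_curve Q' P'" using f(2)[OF P(2)] P(3) by auto
    have "L' = L \<and> Q' = Q" using LQ LQ' line_not_conic by (metis doubleton_eq_iff)
    then show "P = P'" using tangent_line_meets_once LQ LQ' by metis
  qed
  then have "card (f ` ?N) = 4" using non_ordinary by (simp add: card_image)
  moreover have "f ` ?N \<subseteq> {1..4}" using f(1) by blast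
  ultimately have "f ` ?N = {1..4}" by (intro card_subset_eq) auto
  then have "\<forall>i\<in>{1..4}. \<exists>P. ?R P i" using f(2) by (metis imageE)
  then show ?thesis by metis
qed

end

section \<open>The combinatorics of the base points\<close>

text \<open>Glues bijections between the classes with equal invariant. It will match base points
  with the listed quadruple points, the invariant being the set of lines through the point.\<close>

lemma ex_bij_respecting:
  assumes "finite A" "finite B" "\<And>s. card {x \<in> A. f x = s} = card {y \<in> B. g y = s}"
  obtains h where "bij_betw h A B" "\<And>x. x \<in> A \<Longrightarrow> g (h x) = f x"
proof -
  have "\<exists>h. bij_betw h {x \<in> A. f x = s} {y \<in> B. g y = s}" for s
    using assms by (intro finite_same_card_bij) auto
  then obtain H where H: "\<And>s. bij_betw (H s) {x \<in> A. f x = s} {y \<in> B. g y = s}" by metis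
  define h where "h x = H (f x) x" for x
  have h: "h x \<in> B" "g (h x) = f x" if "x \<in> A" for x
    using bij_betwE[OF H[of "f x"]] that by (auto simp: h_def)
  have "bij_betw h A B"
  proof (rule bij_betwI')
    fix x y assume xy: "x \<in> A" "y \<in> A"
    show "h x = h y \<longleftrightarrow> x = y"
    proof
      assume e: "h x = h y"
      then have "f x = f y" using h(2) xy by metis
      then show "x = y"
        using e bij_betw_imp_inj_on[OF H[of "f x"]] xy unfolding h_def inj_on_def by auto
    qed simp
  next
    fix y assume "y \<in> B"
    then have "y \<in> H (g y) ` {x \<in> A. f x = g y}" using bij_betw_imp_surj_on[OF H] by blast
    then obtain x where "x \<in> A" "f x = g y" "y = H (g y) x" by blast
    then show "\<exists>x\<in>A. y = h x" by (intro bexI[of _ x]) (simp_all add: h_def)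
  qed (use h in blast)
  then show thesis using h(2) that by blast
qed

text \<open>The indices of the lines through each point of \<open>quadruple_points\<close>, in the
  same order; the conics through the point carry the complementary indices.\<close>

definition line_sets :: "nat set list" where
  "line_sets = [{3, 4}, {}, {}, {}, {1, 2}, {2, 3}, {2, 4}, {1, 3}, {1, 4}]"

lemma less_9_cases:
  "(k::nat) < 9 \<longleftrightarrow> k \<in> {0, 1, 2, 3, 4, 5, 6, 7, 8}"
  by auto

lemma atLeastAtMost_1_4: "{1..4} = {1, 2, 3, 4 :: nat}"
  by auto

lemma quadruple_points_nth:
  assumes "k < 9"
  shows "quadruple_points ! k = (\<lambda>i. if i \<in> line_sets ! k then Line i else Conic i) ` {1..4}"
  using assms unfolding less_9_cases atLeastAtMost_1_4
  by (elim insertE) (auto simp: quadruple_points_def line_sets_def)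

lemma card_line_sets:
  "card {k \<in> {..<9}. line_sets ! k = {}} = 3"
  "s \<in> set line_sets \<Longrightarrow> s \<noteq> {} \<Longrightarrow> card {k \<in> {..<9}. line_sets ! k = s} = 1"
proof -
  have "{k \<in> {..<9}. line_sets ! k = {}} = {1, 2, 3}"
    by (auto simp: less_9_cases line_sets_def)
  then show "card {k \<in> {..<9}. line_sets ! k = {}} = 3" by simp
next
  assume s: "s \<in> set line_sets" "s \<noteq> {}"
  have "s = {3, 4} \<or> s = {1, 2} \<or> s = {2, 3} \<or> s = {2, 4} \<or> s = {1, 3} \<or> s = {1, 4}"
    using s by (auto simp: line_sets_def)
  moreover have "{k \<in> {..<9}. line_sets ! k = {3, 4}} = {0}"
    "{k \<in> {..<9}. line_sets ! k = {1, 2}} = {4}" "{k \<in> {..<9}. line_sets ! k = {2, 3}} = {5}"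
    "{k \<in> {..<9}. line_sets ! k = {2, 4}} = {6}" "{k \<in> {..<9}. line_sets ! k = {1, 3}} = {7}"
    "{k \<in> {..<9}. line_sets ! k = {1, 4}} = {8}"
    by (auto simp: less_9_cases line_sets_def doubleton_eq_iff)
  ultimately show "card {k \<in> {..<9}. line_sets ! k = s} = 1" by (elim disjE; simp)
qed

lemma line_sets_pair:
  assumes "s \<in> set line_sets" "s \<noteq> {}"
  shows "\<exists>i j. s = {i, j} \<and> i \<in> {1..4} \<and> j \<in> {1..4} \<and> i \<noteq> j"
proof -
  have pair: "\<exists>i j. {a, b} = {i, j} \<and> i \<in> {1..4} \<and> j \<in> {1..4} \<and> i \<noteq> j"
    if "a \<in> {1..4}" "b \<in> {1..4}" "a \<noteq> b" for a b :: nat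
    using that by blast
  consider "s = {3, 4}" | "s = {1, 2}" | "s = {2, 3}" | "s = {2, 4}" | "s = {1, 3}" | "s = {1, 4}"
    using assms by (auto simp: line_sets_def)
  then show ?thesis
  proof cases
    case 1
    show ?thesis unfolding 1 by (rule pair) simp_all
  next
    case 2
    show ?thesis unfolding 2 by (rule pair) simp_all
  next
    case 3
    show ?thesis unfolding 3 by (rule pair) simp_all
  next
    case 4
    show ?thesis unfolding 4 by (rule pair) simp_all
  next
    case 5
    show ?thesis unfolding 5 by (rule pair) simp_all
  next
    case 6
    show ?thesis unfolding 6 by (rule pair) simp_all
  qed
qed

text \<open>A second context, because \<open>L\<close>, \<open>Q\<close> and \<open>T\<close> can be
  chosen only once every fiber is known to be a conic with a tangent line.\<close>

locale tangent_arrangement = pencil_arrangement +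
  fixes L Q :: "nat \<Rightarrow> poly3" and T :: "nat \<Rightarrow> proj_plane"
  assumes tangent_fibers: "\<And>i. i \<in> {1..4} \<Longrightarrow> Irr (C i) = {L i, Q i} \<and> is_line (L i) \<and>
    is_smooth_conic (Q i) \<and> on_curve (L i) (T i) \<and> on_curve (Q i) (T i) \<and> tangent_at (L i) (Q i) (T i)"
begin

definition lines_at :: "proj_plane \<Rightarrow> nat set" where
  "lines_at P = {i \<in> {1..4}. on_curve (L i) P}"

lemma finite_lines_at: "finite (lines_at P)"
  by (simp add: lines_at_def)

lemma components: "Irr \<C> = L ` {1..4} \<union> Q ` {1..4}"
  unfolding Irr_arrangement using tangent_fibers by auto

lemma line_neq_conic: "i \<in> {1..4} \<Longrightarrow> j \<in> {1..4} \<Longrightarrow> L i \<noteq> Q j"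
  using tangent_fibers line_not_conic by metis

lemma component_index:
  assumes "i \<in> {1..4}" "j \<in> {1..4}" "A \<in> {L i, Q i}" "A \<in> {L j, Q j}"
  shows "i = j"
  using Irr_disjoint[OF assms(1,2)] tangent_fibers[OF assms(1)] tangent_fibers[OF assms(2)] assms(3,4)
  by blast

lemma inj_lines: "inj_on L {1..4}"
  by (rule inj_onI) (rule component_index, auto)

lemma inj_conics: "inj_on Q {1..4}"
  by (rule inj_onI) (rule component_index[of _ _ "Q _"], auto)

lemma transversal_components:
  assumes "i \<in> {1..4}" "j \<in> {1..4}" "i \<noteq> j" "A \<in> {L i, Q i}" "B \<in> {L j, Q j}"
    "on_curve A P" "on_curve B P"
  shows "P \<in> base_points F G" "\<not> tangent_at A B P"
  using different_fibers_transversal[OF assms(1,2,3), of A P B] assms tangent_fibers by auto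

lemma base_conic_iff:
  assumes "P \<in> base_points F G" "i \<in> {1..4}"
  shows "on_curve (Q i) P \<longleftrightarrow> \<not> on_curve (L i) P"
proof -
  obtain D where "comps_at (Irr (C i)) P = {D}" using base_point_comps[OF assms] by blast
  then have "{A \<in> {L i, Q i}. on_curve A P} = {D}"
    using tangent_fibers[OF assms(2)] by (simp add: comps_at_def)
  then have "(A = L i \<or> A = Q i) \<and> on_curve A P \<longleftrightarrow> A = D" for A by blast
  then show ?thesis using line_neq_conic[OF assms(2,2)] by metis
qed

lemma tangency_unique:
  "i \<in> {1..4} \<Longrightarrow> on_curve (L i) P \<Longrightarrow> on_curve (Q i) P \<Longrightarrow> P = T i"
  using tangent_line_meets_once tangent_fibers by metis

lemma tangency_not_base: "i \<in> {1..4} \<Longrightarrow> T i \<notin> base_points F G"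
  using base_conic_iff tangent_fibers by blast

lemma tangency_other:
  assumes "i \<in> {1..4}" "j \<in> {1..4}" "i \<noteq> j"
  shows "\<not> on_curve (L j) (T i)" "\<not> on_curve (Q j) (T i)"
  using transversal_components(1)[OF assms, of "L i" _ "T i"] tangent_fibers[OF assms(1)]
    tangency_not_base[OF assms(1)] by auto

lemma lines_meet_base:
  assumes "i \<in> {1..4}" "j \<in> {1..4}" "i \<noteq> j"
  shows "\<exists>P\<in>base_points F G. on_curve (L i) P \<and> on_curve (L j) P"
  using lines_meet[of "L i" "L j"] tangent_fibers assms transversal_components(1)[OF assms, of "L i" "L j"]
  by blast

lemma lines_meet_once:
  assumes "i \<in> {1..4}" "j \<in> {1..4}" "i \<noteq> j"
    "on_curve (L i) P" "on_curve (L j) P" "on_curve (L i) P'" "on_curve (L j) P'"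
  shows "P = P'"
proof -
  have "normalize (L i) \<noteq> normalize (L j)"
    using Irr_normalize tangent_fibers assms(1-3) inj_lines
    by (metis inj_onD insertI1)
  then show ?thesis using lines_meet_unique tangent_fibers assms by metis
qed

lemma even_lines_at:
  assumes "P \<in> base_points F G"
  shows "even (card (lines_at P))"
proof -
  have "{A \<in> Irr \<C>. is_line A \<and> on_curve A P} = L ` lines_at P"
    using tangent_fibers by (auto simp: components lines_at_def dest: line_not_conic)
  moreover have "inj_on L (lines_at P)"
    by (rule inj_on_subset[OF inj_lines]) (auto simp: lines_at_def)
  ultimately show ?thesis using even_lines[OF assms] by (simp add: card_image)
qed

lemma lines_at_not_singleton:
  assumes "P \<in> base_points F G"
  shows "lines_at P \<noteq> {i}"
proof
  assume "lines_at P = {i}"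
  then have "card (lines_at P) = 1" by simp
  then show False using even_lines_at[OF assms] by simp
qed

text \<open>A point on all four lines would leave no base point for \<open>L 1 \<inter> Q 2\<close>.\<close>

lemma not_all_lines:
  assumes P: "P \<in> base_points F G"
  shows "lines_at P \<noteq> {1..4}"
proof
  assume all: "lines_at P = {1..4}"
  have one_two: "(1::nat) \<in> {1..4}" "(2::nat) \<in> {1..4}" "(1::nat) \<noteq> 2" by auto
  obtain P' where P': "on_curve (L 1) P'" "on_curve (Q 2) P'"
    using line_conic_meet[of "L 1" "Q 2"] tangent_fibers one_two by blast
  have base': "P' \<in> base_points F G"
    using transversal_components(1)[OF one_two, of "L 1" "Q 2"] P' by blast
  \<comment> \<open>By parity a further line \<open>L j\<close> passes through the common point of
    \<open>L 1\<close> and \<open>Q 2\<close>. As \<open>L 1\<close> and \<open>L j\<close> already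
    meet at \<open>P\<close>, the two points agree, yet \<open>P\<close> lies on \<open>L 2\<close>
    and hence not on \<open>Q 2\<close>.\<close>
  have "lines_at P' \<noteq> {1}" by (rule lines_at_not_singleton[OF base'])
  moreover have "1 \<in> lines_at P'" using P' by (simp add: lines_at_def)
  ultimately obtain j where j: "j \<in> lines_at P'" "j \<noteq> 1" by blast
  then have "j \<in> {1..4}" "on_curve (L j) P'" by (auto simp: lines_at_def)
  moreover have on_P: "on_curve (L k) P" if "k \<in> {1..4}" for k
    using all that unfolding lines_at_def by blast
  ultimately have "P' = P" using lines_meet_once[of 1 j P' P] one_two j P' by auto
  then show False using base_conic_iff[OF P one_two(2)] P' on_P[OF one_two(2)] by simp
qed

text \<open>The number of lines is even, at least two and less than four.\<close>

lemma lines_at_pair: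
  assumes P: "P \<in> base_points F G" and ij: "i \<in> lines_at P" "j \<in> lines_at P" "i \<noteq> j"
  shows "lines_at P = {i, j}"
proof -
  have sub: "lines_at P \<subset> {1..4}" using not_all_lines[OF P] by (auto simp: lines_at_def)
  then have "card (lines_at P) < 4" using psubset_card_mono[of "{1..4::nat}"] by simp
  moreover have "{i, j} \<subseteq> lines_at P" "card {i, j} = 2" using ij by auto
  moreover have "card (lines_at P) \<noteq> 3" using even_lines_at[OF P] by (metis odd_numeral)
  moreover have "2 \<le> card (lines_at P)"
    using card_mono[OF finite_lines_at calculation(2)] calculation(3) by simp
  ultimately have "card {i, j} = card (lines_at P)" by linarith
  then show ?thesis
    using card_subset_eq[OF finite_lines_at \<open>{i, j} \<subseteq> lines_at P\<close>] by simp
qed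

lemma lines_at_cases:
  assumes P: "P \<in> base_points F G"
  shows "lines_at P \<in> set line_sets"
proof (cases "lines_at P = {}")
  case False
  then obtain i where i: "i \<in> lines_at P" by blast
  moreover have "lines_at P \<noteq> {i}" by (rule lines_at_not_singleton[OF P])
  ultimately obtain j where j: "j \<in> lines_at P" "i \<noteq> j" by blast
  have "i \<in> {1, 2, 3, 4}" "j \<in> {1, 2, 3, 4}"
    using i j unfolding atLeastAtMost_1_4[symmetric] by (auto simp: lines_at_def)
  then show ?thesis
    unfolding lines_at_pair[OF P i j] using j(2) by (auto simp: line_sets_def doubleton_eq_iff)
qed (simp add: line_sets_def)

lemma card_pair_points:
  assumes "i \<in> {1..4}" "j \<in> {1..4}" "i \<noteq> j"
  shows "\<exists>P. {P \<in> base_points F G. lines_at P = {i, j}} = {P}"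
proof -
  obtain P where P: "P \<in> base_points F G" "on_curve (L i) P" "on_curve (L j) P"
    using lines_meet_base[OF assms] by blast
  have "lines_at P = {i, j}"
    using lines_at_pair[OF P(1)] assms P by (simp add: lines_at_def)
  moreover have "P' = P" if "lines_at P' = {i, j}" for P'
  proof -
    have "i \<in> lines_at P'" "j \<in> lines_at P'" using that by auto
    then show ?thesis using lines_meet_once[OF assms] P by (auto simp: lines_at_def)
  qed
  ultimately show ?thesis using P(1) by blast
qed

lemma conics_meet:
  assumes "i \<in> {1..4}" "j \<in> {1..4}" "i \<noteq> j"
  shows "card {P. on_curve (Q i) P \<and> on_curve (Q j) P} = 4"
  using tangent_fibers[OF assms(1)] tangent_fibers[OF assms(2)] tangency_other(2)[OF assms]
    transversal_components(2)[OF assms, of "Q i" "Q j"]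
  by (intro card_conic_inter_conic[of _ _ "T i"]) auto

lemma card_conic_points: "card {P \<in> base_points F G. lines_at P = {}} = 3"
proof -
  let ?A = "{P \<in> base_points F G. lines_at P = {}}"
  have ij: "(1::nat) \<in> {1..4}" "(2::nat) \<in> {1..4}" "(1::nat) \<noteq> 2" by auto
  obtain P where P: "{P \<in> base_points F G. lines_at P = {3, 4}} = {P}"
    using card_pair_points[of 3 4] by auto
  have "{P. on_curve (Q 1) P \<and> on_curve (Q 2) P} = {P \<in> base_points F G. 1 \<notin> lines_at P \<and> 2 \<notin> lines_at P}"
    using transversal_components(1)[OF ij, of "Q 1" "Q 2"] base_conic_iff ij
    unfolding lines_at_def by blast
  \<comment> \<open>The only possible line sets that avoid both 1 and 2 are \<open>{}\<close> and
    \<open>{3, 4}\<close>.\<close>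
  also have "\<dots> = ?A \<union> {P \<in> base_points F G. lines_at P = {3, 4}}"
  proof -
    have "lines_at P = {} \<or> lines_at P = {3, 4}"
      if "P \<in> base_points F G" "1 \<notin> lines_at P" "2 \<notin> lines_at P" for P
      using lines_at_cases[OF that(1)] that(2,3) by (auto simp: line_sets_def)
    then show ?thesis by auto
  qed
  finally have "{P. on_curve (Q 1) P \<and> on_curve (Q 2) P} = insert P ?A" unfolding P by simp
  then have "card (insert P ?A) = 4" using conics_meet[OF ij] by simp
  moreover have "P \<notin> ?A" using P by auto
  \<comment> \<open>An infinite set has \<open>card\<close> equal to 0, so the count of four also
    gives finiteness.\<close>
  moreover have "finite ?A" using calculation(1) by (metis card.infinite finite_insert zero_neq_numeral)
  ultimately show ?thesis by simp
qed

lemma card_lines_at: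
  "card {P \<in> base_points F G. lines_at P = s} = card {k \<in> {..<9}. line_sets ! k = s}"
proof (cases "s \<in> set line_sets")
  case True
  show ?thesis
  proof (cases "s = {}")
    case True
    then show ?thesis using card_conic_points card_line_sets(1) by simp
  next
    case False
    then obtain i j where s: "s = {i, j}" and ij: "i \<in> {1..4}" "j \<in> {1..4}" "i \<noteq> j"
      using line_sets_pair[OF True] by blast
    obtain P where "{P \<in> base_points F G. lines_at P = s} = {P}"
      using card_pair_points[OF ij] unfolding s by blast
    then show ?thesis using card_line_sets(2)[OF True False] by simp
  qed
next
  case False
  then have "{P \<in> base_points F G. lines_at P = s} = {}" using lines_at_cases by blast
  moreover have "length line_sets = 9" by (simp add: line_sets_def)
  then have "{k \<in> {..<9}. line_sets ! k = s} = {}" using False nth_mem by force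
  ultimately show ?thesis by (simp only: card.empty)
qed

text \<open>Every class has positive \<open>card\<close>, which excludes infinite classes, and
  \<open>line_sets\<close> lists all the classes that occur.\<close>

lemma finite_base_points: "finite (base_points F G)"
proof -
  have "finite {P \<in> base_points F G. lines_at P = s}" if "s \<in> set line_sets" for s
  proof -
    have "card {P \<in> base_points F G. lines_at P = s} > 0"
      unfolding card_lines_at using card_line_sets that by (cases "s = {}") auto
    then show ?thesis using card_gt_0_iff by blast
  qed
  then have "finite (\<Union>s\<in>set line_sets. {P \<in> base_points F G. lines_at P = s})" by blast
  then show ?thesis by (rule rev_finite_subset) (use lines_at_cases in auto)
qed

section \<open>The weak combinatorial type\<close>

lemma comps_at_base:
  assumes "P \<in> base_points F G"
  shows "comps_at (Irr \<C>) P = (\<lambda>i. if i \<in> lines_at P then L i else Q i) ` {1..4}"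
  using base_conic_iff[OF assms] unfolding comps_at_def components lines_at_def by auto

lemma comps_at_tangency:
  assumes "i \<in> {1..4}"
  shows "comps_at (Irr \<C>) (T i) = {L i, Q i}"
proof -
  have "on_curve (L j) (T i) \<longleftrightarrow> j = i" "on_curve (Q j) (T i) \<longleftrightarrow> j = i" if "j \<in> {1..4}" for j
    using tangent_fibers[OF assms] tangency_other[OF assms that] by auto
  then show ?thesis using assms unfolding comps_at_def components by auto
qed

text \<open>Two components through a point belong either to the same fiber, and then meet at its
  tangency, or to different fibers, and then meet at a base point.\<close>

lemma Sing_arrangement: "Sing \<C> = base_points F G \<union> T ` {1..4}"
proof (intro equalityI subsetI)
  fix P assume "P \<in> Sing \<C>"
  then obtain D E where DE: "D \<in> comps_at (Irr \<C>) P" "E \<in> comps_at (Irr \<C>) P" "D \<noteq> E"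
    using reduced_curve_Sing[OF reduced_arrangement] by blast
  then obtain i j where ij: "i \<in> {1..4}" "j \<in> {1..4}" "D \<in> {L i, Q i}" "E \<in> {L j, Q j}"
    unfolding comps_at_def components by blast
  have on: "on_curve D P" "on_curve E P" using DE by (auto simp: comps_at_def)
  show "P \<in> base_points F G \<union> T ` {1..4}"
  proof (cases "i = j")
    case True
    then have "on_curve (L i) P" "on_curve (Q i) P" using ij on DE(3) by auto
    then show ?thesis using tangency_unique ij(1) by blast
  next
    case False
    then show ?thesis using transversal_components(1)[OF ij(1,2)] ij on by blast
  qed
next
  fix P assume "P \<in> base_points F G \<union> T ` {1..4}"
  then show "P \<in> Sing \<C>"
  proof
    assume P: "P \<in> base_points F G"
    let ?c = "\<lambda>i. if i \<in> lines_at P then L i else Q i"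
    have "?c 1 \<noteq> ?c 2" using component_index[of 1 2 "?c 1"] by auto
    moreover have "?c 1 \<in> comps_at (Irr \<C>) P" "?c 2 \<in> comps_at (Irr \<C>) P"
      unfolding comps_at_base[OF P] by (rule imageI, simp)+
    ultimately show ?thesis using reduced_curve_Sing[OF reduced_arrangement] by blast
  next
    assume "P \<in> T ` {1..4}"
    then show ?thesis
      using reduced_curve_Sing[OF reduced_arrangement] comps_at_tangency line_neq_conic by fastforce
  qed
qed

lemma base_intersection_number:
  assumes P: "P \<in> base_points F G" and DE: "D \<in> comps_at (Irr \<C>) P" "E \<in> comps_at (Irr \<C>) P" "D \<noteq> E"
  shows "\<not> tangent_at D E P"
    "intersection_number (multiples (local_eq D P)) (multiples (local_eq E P)) = 1"
proof -
  let ?c = "\<lambda>i. if i \<in> lines_at P then L i else Q i"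
  obtain i where i: "i \<in> {1..4}" "D = ?c i" using DE(1) unfolding comps_at_base[OF P] by blast
  obtain j where j: "j \<in> {1..4}" "E = ?c j" using DE(2) unfolding comps_at_base[OF P] by blast
  have "i \<noteq> j" using i(2) j(2) DE(3) by metis
  then have ij: "i \<in> {1..4}" "j \<in> {1..4}" "i \<noteq> j" "D \<in> {L i, Q i}" "E \<in> {L j, Q j}"
    using i j by simp_all
  have on: "on_curve D P" "on_curve E P" using DE by (auto simp: comps_at_def)
  show nt: "\<not> tangent_at D E P" using transversal_components(2)[OF ij on] by blast
  show "intersection_number (multiples (local_eq D P)) (multiples (local_eq E P)) = 1"
    using nt reduced_curve_comps(3)[OF reduced_arrangement] DE
    by (intro intersection_number_transversal) (auto simp: tangent_at_def)
qed

lemma tangency_intersection_number: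
  assumes i: "i \<in> {1..4}" and DE: "D \<in> comps_at (Irr \<C>) (T i)" "E \<in> comps_at (Irr \<C>) (T i)" "D \<noteq> E"
  shows "intersection_number (multiples (local_eq D (T i))) (multiples (local_eq E (T i))) = 2"
proof -
  have "D = L i \<and> E = Q i \<or> D = Q i \<and> E = L i"
    using DE unfolding comps_at_tangency[OF i] by blast
  then show ?thesis
    using tangent_line_intersection_number(1)[of "L i" "Q i" "T i"] tangent_fibers[OF i]
      intersection_number_commute by auto
qed

text \<open>At a base point distinct components have distinct tangents; at \<open>T i\<close> the
  equation of the line does not divide that of the conic. This uniqueness makes the description by
  \<open>THE\<close> in \<open>phi\<close> meaningful.\<close>

lemma branch_determines_component:
  assumes P: "P \<in> Sing \<C>" and DE: "D \<in> comps_at (Irr \<C>) P" "E \<in> comps_at (Irr \<C>) P"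
    and eq: "multiples (local_eq D P) = multiples (local_eq E P)"
  shows "D = E"
proof (rule ccontr)
  assume "D \<noteq> E"
  show False
  proof (cases "P \<in> base_points F G")
    case True
    then show False
      using base_intersection_number(1)[OF True DE \<open>D \<noteq> E\<close>] eq
        comps_tangent_eq_iff[OF reduced_arrangement DE] by simp
  next
    case False
    then obtain i where i: "i \<in> {1..4}" "P = T i" using P unfolding Sing_arrangement by blast
    then have "D = L i \<and> E = Q i \<or> D = Q i \<and> E = L i"
      using DE \<open>D \<noteq> E\<close> comps_at_tangency[OF i(1)] by auto
    then have "local_eq (L i) P dvd local_eq (Q i) P" using eq by (auto simp: multiples_eq_iff)
    then show False
      using tangent_line_intersection_number(2)[of "L i" "Q i" "T i"] tangent_fibers[OF i(1)] i(2)
      by blast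
  qed
qed

lemma component_of_branch:
  assumes P: "P \<in> Sing \<C>" and D: "D \<in> comps_at (Irr \<C>) P"
  shows "phi (weak_type_of \<C>) P (multiples (local_eq D P)) = D"
proof -
  have comp: "is_component E" if "E \<in> Irr \<C>" for E
    using reduced_arrangement that by (auto simp: reduced_curve_def)
  have br: "B \<in> branches E P \<longleftrightarrow> on_curve E P \<and> B = multiples (local_eq E P)" if "E \<in> Irr \<C>" for E B
    unfolding reduced_curve_branches[OF reduced_curve_singleton[OF comp[OF that]]]
    by (auto simp: comps_at_def)
  have "(THE E. E \<in> Irr \<C> \<and> multiples (local_eq D P) \<in> branches E P) = D"
  proof (rule the_equality)
    show "D \<in> Irr \<C> \<and> multiples (local_eq D P) \<in> branches D P"
      using D br by (auto simp: comps_at_def)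
    fix E assume "E \<in> Irr \<C> \<and> multiples (local_eq D P) \<in> branches E P"
    then have "E \<in> comps_at (Irr \<C>) P" "multiples (local_eq E P) = multiples (local_eq D P)"
      using br by (auto simp: comps_at_def)
    then show "E = D" using branch_determines_component[OF P] D by blast
  qed
  then show ?thesis by (simp add: weak_type_of_def)
qed

text \<open>Everything that is not one of the \<open>L i\<close> gets a conic label, which is
  meaningful only on \<open>Irr \<C>\<close>.\<close>

definition label :: "poly3 \<Rightarrow> component" where
  "label D = (if D \<in> L ` {1..4} then Line (inv_into {1..4} L D) else Conic (inv_into {1..4} Q D))"

lemma label_simps:
  assumes "i \<in> {1..4}"
  shows "label (L i) = Line i" "label (Q i) = Conic i"
proof -
  have "Q i \<notin> L ` {1..4}" using line_neq_conic assms by (metis imageE)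
  then show "label (L i) = Line i" "label (Q i) = Conic i"
    using assms inv_into_f_f[OF inj_lines] inv_into_f_f[OF inj_conics] by (simp_all add: label_def)
qed

lemma bij_label: "bij_betw label (Irr \<C>) (Conic ` {1..4} \<union> Line ` {1..4})"
proof (rule bij_betw_imageI)
  show "label ` Irr \<C> = Conic ` {1..4} \<union> Line ` {1..4}"
    unfolding components image_Un image_image Un_commute[of "Conic ` _"]
    by (intro arg_cong2[where f = "(\<union>)"] image_cong refl) (simp_all add: label_simps)
  show "inj_on label (Irr \<C>)"
    unfolding components by (rule inj_onI) (auto simp: label_simps)
qed

lemma inj_tangencies: "inj_on T {1..4}"
  using tangency_other(1) tangent_fibers by (metis inj_onI)

theorem weak_type: "weak_type_iso (weak_type_of \<C>) W_type"
proof -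
  \<comment> \<open>The number of points with a given line set is the same on both sides, so the
    base points can be numbered in the order of \<open>line_sets\<close>.\<close>
  obtain h where h: "bij_betw h (base_points F G) {..<9}"
      "\<And>P. P \<in> base_points F G \<Longrightarrow> line_sets ! h P = lines_at P"
    using ex_bij_respecting[OF finite_base_points finite_lessThan card_lines_at] by metis
  define \<tau> where
    "\<tau> P = (if P \<in> base_points F G then Quadruple (h P) else Tangency (inv_into {1..4} T P))" for P
  have \<tau>_base: "\<tau> P = Quadruple (h P)" if "P \<in> base_points F G" for P
    using that by (simp add: \<tau>_def)
  have \<tau>_T: "\<tau> (T i) = Tangency i" if "i \<in> {1..4}" for i
    using that tangency_not_base inv_into_f_f[OF inj_tangencies] by (simp add: \<tau>_def)
  \<comment> \<open>A branch in \<open>W_type\<close> is named by its component, so it has to be the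
    label of the component that carries the given branch.\<close>
  define \<beta> where "\<beta> P B = label (phi (weak_type_of \<C>) P B)" for P B
  note branches = reduced_curve_branches[OF reduced_arrangement]
  have sel: "labels (weak_type_of \<C>) = Irr \<C>" "points (weak_type_of \<C>) = Sing \<C>"
      "Delta (weak_type_of \<C>) = branches \<C>" "inum (weak_type_of \<C>) = (\<lambda>P. intersection_number)"
    by (simp_all add: weak_type_of_def)
  have inj_label: "inj_on label (comps_at (Irr \<C>) P)" for P
    using bij_label by (auto simp: bij_betw_def comps_at_def intro: inj_on_subset)
  have delta: "label ` comps_at (Irr \<C>) P = Delta W_type (\<tau> P)" if P: "P \<in> Sing \<C>" for P
  proof (cases "P \<in> base_points F G")
    case True
    then have "h P < 9" using h(1) by (auto simp: bij_betw_def)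
    have "label ` comps_at (Irr \<C>) P =
        (\<lambda>i. if i \<in> lines_at P then Line i else Conic i) ` {1..4}"
      unfolding comps_at_base[OF True] image_image by (rule image_cong) (auto simp: label_simps)
    also have "\<dots> = quadruple_points ! h P"
      using quadruple_points_nth[OF \<open>h P < 9\<close>] h(2)[OF True] by simp
    finally show ?thesis using True by (simp add: \<tau>_base W_type_def)
  next
    case False
    then obtain i where i: "i \<in> {1..4}" "P = T i" using P unfolding Sing_arrangement by blast
    then show ?thesis
      using comps_at_tangency[OF i(1)] by (simp add: \<tau>_T label_simps W_type_def)
  qed
  have bij_\<beta>: "bij_betw (\<beta> P) (branches \<C> P) (Delta W_type (\<tau> P))" if P: "P \<in> Sing \<C>" for P
  proof (rule bij_betw_imageI)
    show "\<beta> P ` branches \<C> P = Delta W_type (\<tau> P)"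
      unfolding branches image_image delta[OF P, symmetric] \<beta>_def
      using component_of_branch[OF P] by (intro image_cong) auto
    show "inj_on (\<beta> P) (branches \<C> P)"
    proof (rule inj_onI)
      fix B B' assume "B \<in> branches \<C> P" "B' \<in> branches \<C> P" "\<beta> P B = \<beta> P B'"
      then obtain D D' where "D \<in> comps_at (Irr \<C>) P" "B = multiples (local_eq D P)"
          "D' \<in> comps_at (Irr \<C>) P" "B' = multiples (local_eq D' P)" "label D = label D'"
        unfolding branches \<beta>_def using component_of_branch[OF P] by auto
      then show "B = B'" using inj_label[of P] by (auto simp: inj_on_def)
    qed
  qed
  have inum_\<beta>: "inum W_type (\<tau> P) (\<beta> P B) (\<beta> P B') = intersection_number B B'"
    if P: "P \<in> Sing \<C>" and B: "B \<in> branches \<C> P" "B' \<in> branches \<C> P"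
      and ne: "phi (weak_type_of \<C>) P B \<noteq> phi (weak_type_of \<C>) P B'" for P B B'
  proof -
    obtain D D' where D: "D \<in> comps_at (Irr \<C>) P" "B = multiples (local_eq D P)"
        "D' \<in> comps_at (Irr \<C>) P" "B' = multiples (local_eq D' P)"
      using B unfolding branches by blast
    then have "D \<noteq> D'" using ne by blast
    show ?thesis
    proof (cases "P \<in> base_points F G")
      case True
      then show ?thesis
        using base_intersection_number(2)[OF True D(1,3) \<open>D \<noteq> D'\<close>] D
        by (simp add: \<tau>_base W_type_def)
    next
      case False
      then obtain i where i: "i \<in> {1..4}" "P = T i" using P unfolding Sing_arrangement by blast
      then show ?thesis
        using tangency_intersection_number[OF i(1), of D D'] D \<open>D \<noteq> D'\<close>
        by (simp add: \<tau>_T W_type_def)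
    qed
  qed
  have bij_\<tau>: "bij_betw \<tau> (Sing \<C>) (points W_type)"
  proof -
    have "bij_betw (Quadruple \<circ> h) (base_points F G) (Quadruple ` {..<9})"
      by (rule bij_betw_trans[OF h(1)]) (simp add: bij_betw_def inj_on_def)
    then have "bij_betw \<tau> (base_points F G) (Quadruple ` {..<9})"
      by (rule bij_betw_cong[THEN iffD1, rotated]) (simp add: \<tau>_base)
    moreover have "bij_betw \<tau> (T ` {1..4}) (Tangency ` {1..4})"
    proof (rule bij_betw_imageI)
      show "inj_on \<tau> (T ` {1..4})" by (rule inj_onI) (auto simp: \<tau>_T)
      show "\<tau> ` T ` {1..4} = Tangency ` {1..4}"
        unfolding image_image by (rule image_cong) (simp_all add: \<tau>_T)
    qed
    moreover have "Quadruple ` {..<9} \<inter> Tangency ` {1..4} = {}" by auto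
    ultimately have "bij_betw \<tau> (base_points F G \<union> T ` {1..4})
        (Quadruple ` {..<9} \<union> Tangency ` {1..4})"
      by (rule bij_betw_combine)
    then show ?thesis by (simp add: Sing_arrangement W_type_def Un_commute)
  qed
  have "phi W_type p b = b" "labels W_type = Conic ` {1..4} \<union> Line ` {1..4}" for p b
    by (simp_all add: W_type_def)
  then show ?thesis
    unfolding weak_type_iso_def sel
    using bij_label bij_\<tau> bij_\<beta> inum_\<beta> \<beta>_def
    by (intro exI[of _ label] exI[of _ \<tau>] exI[of _ \<beta>]) auto
qed

end

theorem theorem22:
  fixes F G \<C> :: poly3 and C :: "nat \<Rightarrow> poly3"
  assumes pencil: "conic_line_pencil 3 F G"
    and fibers: "\<And>i. i \<in> {1..4} \<Longrightarrow> conic_line_fiber F G (C i)"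
    and distinct_fibers: "inj_on (\<lambda>i. normalize (C i)) {1..4}"
    and arrangement: "\<C> = (\<Prod>i\<in>{1..4}. C i)"
    and transversal: "\<And>P i j. P \<in> base_points F G \<Longrightarrow> i \<in> {1..4} \<Longrightarrow> j \<in> {1..4} \<Longrightarrow> i \<noteq> j \<Longrightarrow>
                        transversal_at (C i) (C j) P"
    and non_ordinary: "card (non_ordinary_points \<C>) = 4"
    and even_lines: "\<And>P. P \<in> base_points F G \<Longrightarrow>
                       even (card {L \<in> Irr \<C>. is_line L \<and> on_curve L P})"
  shows "weak_type_iso (weak_type_of \<C>) W_type"
proof -
  interpret pencil_arrangement F G \<C> C
    by (rule pencil_arrangement.intro) (fact assms)+
  obtain L Q T where "\<forall>i\<in>{1..4}. Irr (C i) = {L i, Q i} \<and> is_line (L i) \<and> is_smooth_conic (Q i) \<and>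
      on_curve (L i) (T i) \<and> on_curve (Q i) (T i) \<and> tangent_at (L i) (Q i) (T i)"
    using all_fibers_tangent by blast
  then interpret tangent_arrangement F G \<C> C L Q T
    by unfold_locales blast
  show ?thesis by (rule weak_type)
qed

end
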